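(* For every integer $g\ge 3$ there exist polynomials $C_g,D_g\in\mathbb{C}[x]$ (with coefficients depending on $T$) such that $$w_{1,2}^{(g)}(x)=\frac{C_g(x)}{y(x)^{3g-2}}+\frac{D_g(x)}{y(x)^{3g-1}},$$ where $\deg C_g\le g-1$, $\deg D_g\le g$, $C_g(-x)=(-1)^{g-1}C_g(x)$, $D_g(-x)=(-1)^{g}D_g(x)$, and the coefficient of $x^{g-1}$ in $C_g$ is the negative of the coefficient of $x^{g}$ in $D_g$.
   Context: Fix $T>0$. Let $y(x)=\sqrt{x^2-4T}$ denote the branch analytic on $\mathbb{C}\setminus[-2\sqrt T,2\sqrt T]$ with $y(x)\sim x$ as $x\to\infty$; write $y_i=y(x_i)$. Let $\hbar$ be a parameter (in the application $\hbar=\sqrt{\kappa}-1/\sqrt{\kappa}$, where $\beta=2\kappa$ is the Dyson index of the Gaussian $\beta$-ensemble $\prod_{i<j}|\lambda_i-\lambda_j|^{2\kappa}e^{-\frac{N\kappa}{T}\sum_i\lambda_i^2/2}$). The functions $W_n^{(g)}(x_1,\dots,x_n)$, $n\ge1$, $g\ge0$ (the coefficients of the large-$N$ expansion of the connected correlators of that ensemble), are the symmetric functions determined recursively as follows: $W_1^{(0)}(x)=\tfrac12(x-y(x))$; by convention $W_n^{(-1)}=W_n^{(-2)}=0$; and for every $(n,g)$ with $n\ge1$, $g\ge0$, $(n,g)\neq(1,0)$, writing $I=(x_1,\dots,x_{n-1})$, $$y(x)W_n^{(g)}(x,I)=\hbar\,\partial_xW_n^{(g-1)}(x,I)+W_{n+1}^{(g-2)}(x,x,I)+{\sum_{J\subseteq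 I}}'\sum_{p=0}^{g}W_{|J|+1}^{(p)}(x,J)\,W_{n-|J|}^{(g-p)}(x,I\setminus J)+\sum_{i=1}^{n-1}\frac{\partial}{\partial x_i}\frac{W_{n-1}^{(g)}(x,I\setminus\{x_i\})-W_{n-1}^{(g)}(I)}{x-x_i},$$ where the primed double sum omits the two terms $(J=\emptyset,p=0)$ and $(J=I,p=g)$, and for $n=1$ the last sum is empty. These functions are rational in the $x_i$ and $y_i$, regular on the diagonals, and each $W_n^{(g)}$ is a polynomial in $\hbar$ of degree at most $g$ containing only powers $\hbar^j$ with $j\equiv g \pmod 2$. For $k\ge1$, $g\ge0$ and $0\le r\le g/2$, $w_{k,2r}^{(g)}(x)$ denotes the coefficient of $\hbar^{g-2r}$ in $W_k^{(g)}(x,\dots,x)$ (all $k$ arguments equal to $x$). Thus $w_{1,2}^{(g)}(x)$ is the coefficient of $\hbar^{g-2}$ in $W_1^{(g)}(x)$. *)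

theory Defs
  imports "HOL-Analysis.Analysis" "HOL-Computational_Algebra.Polynomial"
begin

definition cut :: "real \<Rightarrow> complex set" where
  "cut T = complex_of_real ` {-2 * sqrt T .. 2 * sqrt T}"

definition Ucut :: "real \<Rightarrow> complex set" where
  "Ucut T = - cut T"

(* The branch of sqrt(x^2 - 4T) analytic off the cut with y(x) ~ x at infinity:
   y(x) = x * sqrt(1 - 4T/x^2) with the principal square root. *)
definition ybr :: "real \<Rightarrow> complex \<Rightarrow> complex" where
  "ybr T x = x * csqrt (1 - 4 * complex_of_real T / x\<^sup>2)"

(* W g n j xs = coefficient of hbar^j in W_n^{(g)}(xs)  (xs a list of length n).
   loop_family T W: W satisfies the initial condition, the loop equations
   (coefficientwise in hbar, at pairwise distinct points of the domain), and is
   regular on the diagonal x_1 = x_2 (the value there is the limit). *)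
definition loop_family ::
  "real \<Rightarrow> (nat \<Rightarrow> nat \<Rightarrow> nat \<Rightarrow> complex list \<Rightarrow> complex) \<Rightarrow> bool" where
  "loop_family T W \<longleftrightarrow>
     (\<forall>x \<in> Ucut T. W 0 1 0 [x] = (x - ybr T x) / 2 \<and> (\<forall>j\<ge>1. W 0 1 j [x] = 0))
   \<and> (\<forall>g m j x I. 2 \<le> m \<longrightarrow> x \<in> Ucut T \<longrightarrow> length I = m - 2 \<longrightarrow> set I \<subseteq> Ucut T
        \<longrightarrow> distinct (x # I) \<longrightarrow>
        ((\<lambda>z. W g m j (x # z # I)) \<longlongrightarrow> W g m j (x # x # I)) (at x))
   \<and> (\<forall>g n j x I. 1 \<le> n \<longrightarrow> (n, g) \<noteq> (1, 0) \<longrightarrow> x \<in> Ucut T \<longrightarrow>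
        length I = n - 1 \<longrightarrow> set I \<subseteq> Ucut T \<longrightarrow> distinct (x # I) \<longrightarrow>
        ybr T x * W g n j (x # I) =
          (if 1 \<le> g \<and> 1 \<le> j then deriv (\<lambda>t. W (g - 1) n (j - 1) (t # I)) x else 0)
        + (if 2 \<le> g then W (g - 2) (n + 1) j (x # x # I) else 0)
        + (\<Sum>S \<in> Pow {..<n-1}. \<Sum>p \<in> {0..g}.
             if (S = {} \<and> p = 0) \<or> (S = {..<n-1} \<and> p = g) then 0
             else (\<Sum>a \<in> {0..j}. W p (card S + 1) a (x # nths I S)
                    * W (g - p) (n - card S) (j - a) (x # nths I ({..<n-1} - S))))
        + (\<Sum>i < n - 1. deriv (\<lambda>t. (W g (n - 1) j (x # nths I ({..<n-1} - {i}))
                                   - W g (n - 1) j (I[i := t])) / (x - t)) (I ! i)))"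

end

theory Submission
  imports Defs
begin

(*
  Every coefficient in the recursion turns out to be a "y-fraction"
  (A(x) + B(x) y(x)) / y(x)^M with polynomials A, B, encoded by the triple (A,B,M).
  Such triples are closed under the operations the loop equations use (products,
  d/dx, division by y, sums after raising to a common exponent), and evaluation is
  compatible with them.  A weight invariant ("shaped w": degree and parity bounds
  for A and B relative to M - w) and the vanishing of the coefficient of x^(M-w) in
  A + x B ("top coefficient") are preserved by these operations.
*)

section \<open>The branch y(x) = sqrt(x^2 - 4T) off the cut\<close>

lemma zero_in_cut: "0 < T \<Longrightarrow> (0::complex) \<in> cut T"
  unfolding cut_def by (force intro: image_eqI[where x=0])

lemma Ucut_nonzero: "0 < T \<Longrightarrow> x \<in> Ucut T \<Longrightarrow> x \<noteq> 0"
  using zero_in_cut unfolding Ucut_def by auto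

lemma open_Ucut: "open (Ucut T)"
proof -
  have "compact (cut T)" unfolding cut_def
    by (intro compact_continuous_image continuous_intros) auto
  then show ?thesis unfolding Ucut_def by (simp add: compact_imp_closed open_Compl)
qed

(* Off the cut, 1 - 4T/x^2 avoids the branch cut of csqrt (a real x^2 >= 4T would
   put x on the cut), so ybr is holomorphic there. *)
lemma Ucut_notnonpos:
  assumes T: "0 < T" and x: "x \<in> Ucut T"
  shows "1 - 4 * complex_of_real T / x\<^sup>2 \<notin> \<real>\<^sub>\<le>\<^sub>0"
proof
  let ?u = "1 - 4 * complex_of_real T / x\<^sup>2"
  assume h: "?u \<in> \<real>\<^sub>\<le>\<^sub>0"
  define r where "r = Re ?u"
  have r0: "r \<le> 0" and iu: "Im ?u = 0" using h by (auto simp: complex_nonpos_Reals_iff r_def)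
  have ur: "?u = complex_of_real r" using iu by (simp add: complex_eq_iff r_def)
  have x0: "x \<noteq> 0" using Ucut_nonzero[OF T x] .
  have "x\<^sup>2 * (1 - complex_of_real r) = 4 * complex_of_real T"
    using ur x0 by (simp add: field_simps)
  then have "x\<^sup>2 = complex_of_real (4 * T / (1 - r))"
    using r0 by (simp add: field_simps)
  then have e: "x * x = complex_of_real (4 * T / (1 - r))" by (simp add: power2_eq_square)
  have pos: "0 < 4 * T / (1 - r)" using T r0 by auto
  have eRe: "Re x * Re x - Im x * Im x = 4 * T / (1 - r)" using arg_cong[OF e, of Re] by simp
  have eIm: "Re x * Im x + Im x * Re x = 0" using arg_cong[OF e, of Im] by simp
  have "Im x = 0"
  proof (rule ccontr)
    assume ne: "Im x \<noteq> 0"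
    with eIm have "Re x = 0" by simp
    with eRe have "- (Im x * Im x) = 4 * T / (1 - r)" by simp
    moreover have "0 \<le> Im x * Im x" by simp
    ultimately show False using pos by linarith
  qed
  then have xr: "x = complex_of_real (Re x)" by (simp add: complex_eq_iff)
  have "(Re x)\<^sup>2 = 4 * T / (1 - r)" using eRe \<open>Im x = 0\<close> by (simp add: power2_eq_square)
  also have "\<dots> \<le> 4 * T" using T r0 by (simp add: divide_le_eq)
  finally have "sqrt ((Re x)\<^sup>2) \<le> sqrt (4 * T)" by (rule real_sqrt_le_mono)
  then have "\<bar>Re x\<bar> \<le> 2 * sqrt T" by (simp add: real_sqrt_mult)
  then have "x \<in> cut T" unfolding cut_def using xr by (intro image_eqI[where x="Re x"]) auto
  with x show False unfolding Ucut_def by auto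
qed

lemma ybr_sq: "0 < T \<Longrightarrow> x \<in> Ucut T \<Longrightarrow> ybr T x ^ 2 = x ^ 2 - 4 * complex_of_real T"
  using Ucut_nonzero[of T x] by (simp add: ybr_def power_mult_distrib field_simps)

(* y has no zeros off the cut: they would be the endpoints +-2 sqrt T. *)
lemma ybr_nonzero: assumes "0 < T" "x \<in> Ucut T" shows "ybr T x \<noteq> 0"
proof
  assume "ybr T x = 0"
  then have "1 - 4 * complex_of_real T / x\<^sup>2 = 0"
    using Ucut_nonzero[OF assms] by (simp add: ybr_def)
  with Ucut_notnonpos[OF assms] show False by simp
qed

lemma ybr_deriv:
  assumes T: "0 < T" and x: "x \<in> Ucut T"
  shows "(ybr T has_field_derivative x / ybr T x) (at x)"
proof -
  have x0: "x \<noteq> 0" using Ucut_nonzero[OF T x] .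
  define u where "u = (\<lambda>x. 1 - 4 * complex_of_real T / x\<^sup>2)"
  have nn: "u x \<notin> \<real>\<^sub>\<le>\<^sub>0" using Ucut_notnonpos[OF T x] by (simp add: u_def)
  define c where "c = csqrt (u x)"
  have c0: "c \<noteq> 0" using nn by (auto simp: c_def)
  have sq: "c * c = 1 - 4 * complex_of_real T / x\<^sup>2" unfolding c_def u_def by (metis power2_csqrt power2_eq_square)
  have du: "(u has_field_derivative 8 * complex_of_real T / x ^ 3) (at x)"
    unfolding u_def
    by (rule derivative_eq_intros refl | use x0 in \<open>simp add: field_simps power2_eq_square power3_eq_cube\<close>)+
  have dc: "((\<lambda>x. csqrt (u x)) has_field_derivative (8 * complex_of_real T / x ^ 3) / (2 * c)) (at x)"
    unfolding c_def by (rule has_field_derivative_csqrt'[OF du nn])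
  have d: "((\<lambda>x. x * csqrt (u x)) has_field_derivative (1 * c + x * ((8 * complex_of_real T / x ^ 3) / (2 * c)))) (at x)"
    using DERIV_mult[OF DERIV_ident dc] by (simp add: c_def mult.commute)
  have e: "1 * c + x * ((8 * complex_of_real T / x ^ 3) / (2 * c)) = x / ybr T x"
  proof -
    have "x / ybr T x = 1 / c" using x0 c0 by (simp add: ybr_def c_def u_def)
    moreover have "c * (c * (x * x)) = x * x - 4 * complex_of_real T"
      using sq x0 by (simp add: field_simps power2_eq_square)
    ultimately show ?thesis using x0 c0
      by (simp add: field_simps power3_eq_cube power2_eq_square)
  qed
  have "ybr T = (\<lambda>x. x * csqrt (u x))" by (simp add: ybr_def[abs_def] u_def)
  with d e show ?thesis by simp
qed


section \<open>Fractions in y and their algebra\<close>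

(* A triple (A,B,M) stands for the function (A(x) + B(x) y(x)) / y(x)^M. *)
type_synonym yfrac = "complex poly \<times> complex poly \<times> nat"

definition ysq :: "real \<Rightarrow> complex poly" where "ysq T = [:- (4 * complex_of_real T), 0, 1:]"

lemma ysq_eq: "ysq T = [:0,1:] * [:0,1:] - [:4 * complex_of_real T:]"
  by (simp add: ysq_def)

lemma poly_ysq[simp]: "poly (ysq T) x = x\<^sup>2 - 4 * complex_of_real T"
  by (simp add: ysq_def power2_eq_square algebra_simps)

fun yexp :: "yfrac \<Rightarrow> nat" where "yexp (A,B,M) = M"

(* Product, using y^2 = ysq. *)
fun yf_mult :: "real \<Rightarrow> yfrac \<Rightarrow> yfrac \<Rightarrow> yfrac" where
  "yf_mult T (A1,B1,M1) (A2,B2,M2) = (A1*A2 + B1*B2*ysq T, A1*B2 + B1*A2, M1+M2)"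

(* Derivative, using y' = x/y; the exponent grows by 2 (by 1 when M = 0). *)
fun yf_deriv :: "real \<Rightarrow> yfrac \<Rightarrow> yfrac" where
  "yf_deriv T (A,B,M) = (if M = 0 then (pderiv B * ysq T + [:0,1:] * B, pderiv A, 1)
     else (pderiv A * ysq T - smult (of_nat M) ([:0,1:] * A),
           pderiv B * ysq T + [:0,1:] * B - smult (of_nat M) ([:0,1:] * B), M + 2))"

fun yf_divy :: "yfrac \<Rightarrow> yfrac" where "yf_divy (A,B,M) = (A,B,Suc M)"

(* The same function written with one more power of y in the denominator. *)
fun yf_raise :: "real \<Rightarrow> yfrac \<Rightarrow> yfrac" where "yf_raise T (A,B,M) = (B * ysq T, A, Suc M)"

fun yf_add :: "yfrac \<Rightarrow> yfrac \<Rightarrow> yfrac" where "yf_add (A1,B1,M1) (A2,B2,M2) = (A1+A2, B1+B2, M1)"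

fun yf_smult :: "complex \<Rightarrow> yfrac \<Rightarrow> yfrac" where "yf_smult c (A,B,M) = (smult c A, smult c B, M)"

definition yf_raise_to :: "real \<Rightarrow> nat \<Rightarrow> yfrac \<Rightarrow> yfrac" where
  "yf_raise_to T m X = (yf_raise T ^^ (m - yexp X)) X"

definition yf_sum :: "real \<Rightarrow> nat \<Rightarrow> yfrac list \<Rightarrow> yfrac" where
  "yf_sum T m xs = foldr (\<lambda>X acc. yf_add (yf_raise_to T m X) acc) xs (0,0,m)"

lemma yexp_raise[simp]: "yexp (yf_raise T X) = Suc (yexp X)" by (cases X) auto
lemma yexp_raise_pow[simp]: "yexp ((yf_raise T ^^ n) X) = yexp X + n" by (induction n) auto
lemma yexp_raise_to: "yexp X \<le> m \<Longrightarrow> yexp (yf_raise_to T m X) = m" by (simp add: yf_raise_to_def)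
lemma yexp_add[simp]: "yexp (yf_add X Y) = yexp X" by (cases X; cases Y) auto
lemma yexp_mult[simp]: "yexp (yf_mult T X Y) = yexp X + yexp Y" by (cases X; cases Y) auto
lemma yexp_divy[simp]: "yexp (yf_divy X) = Suc (yexp X)" by (cases X) auto
lemma yexp_smult[simp]: "yexp (yf_smult c X) = yexp X" by (cases X) auto
lemma yexp_deriv: "yexp (yf_deriv T X) = (if yexp X = 0 then 1 else yexp X + 2)" by (cases X) auto
lemma yexp_deriv_le: "yexp (yf_deriv T X) \<le> yexp X + 2" by (cases X) auto

lemma yf_sum_cons: "yf_sum T m (X # xs) = yf_add (yf_raise_to T m X) (yf_sum T m xs)"
  by (simp add: yf_sum_def)
lemma yf_sum_nil: "yf_sum T m [] = (0,0,m)" by (simp add: yf_sum_def)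

lemma yexp_sum: "(\<And>X. X \<in> set xs \<Longrightarrow> yexp X \<le> m) \<Longrightarrow> yexp (yf_sum T m xs) = m"
  by (cases xs) (auto simp: yf_sum_nil yf_sum_cons yexp_raise_to)


section \<open>Degree and parity bookkeeping\<close>

(* parity p a: only monomials x^i with i + a even occur in p, i.e. p(-x) = (-1)^a p(x). *)
definition parity :: "complex poly \<Rightarrow> int \<Rightarrow> bool" where
  "parity p a \<longleftrightarrow> (\<forall>i. coeff p i \<noteq> 0 \<longrightarrow> even (int i + a))"

lemma parity_cong: "parity p a \<Longrightarrow> even a = even b \<Longrightarrow> parity p b"
  unfolding parity_def by auto
lemma parity_0[simp]: "parity 0 a" by (simp add: parity_def)
lemma parity_add: assumes "parity p a" "parity q a" shows "parity (p + q) a"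
  unfolding parity_def
proof (intro allI impI)
  fix i assume "coeff (p+q) i \<noteq> 0"
  then have "coeff p i \<noteq> 0 \<or> coeff q i \<noteq> 0" by auto
  then show "even (int i+a)" using assms unfolding parity_def by blast
qed
lemma parity_diff: assumes "parity p a" "parity q a" shows "parity (p - q) a"
  unfolding parity_def
proof (intro allI impI)
  fix i assume "coeff (p-q) i \<noteq> 0"
  then have "coeff p i \<noteq> 0 \<or> coeff q i \<noteq> 0" by auto
  then show "even (int i+a)" using assms unfolding parity_def by blast
qed
lemma parity_smult: "parity p a \<Longrightarrow> parity (smult c p) a"
  unfolding parity_def by auto
lemma parity_mult: assumes "parity p a" "parity q b" shows "parity (p * q) (a + b)"
  unfolding parity_def
proof (intro allI impI)
  fix n assume "coeff (p * q) n \<noteq> 0"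
  then have "(\<Sum>i\<le>n. coeff p i * coeff q (n-i)) \<noteq> 0" by (simp add: coeff_mult)
  then obtain i where i: "i \<in> {..n}" "coeff p i * coeff q (n - i) \<noteq> 0"
    by (meson sum.not_neutral_contains_not_neutral)
  with assms have "even (int i + a)" "even (int (n - i) + b)" unfolding parity_def by auto
  moreover have "int (n - i) = int n - int i" using i(1) by auto
  ultimately show "even (int n + (a + b))" by presburger
qed
lemma parity_pderiv: assumes "parity p a" shows "parity (pderiv p) (a + 1)"
  unfolding parity_def
proof (intro allI impI)
  fix n assume "coeff (pderiv p) n \<noteq> 0"
  then have "coeff p (Suc n) \<noteq> 0" by (simp add: coeff_pderiv)
  with assms have "even (int (Suc n) + a)" unfolding parity_def by blast
  then show "even (int n + (a + 1))" by (simp add: algebra_simps)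
qed
lemma parity_X: "parity [:0,1:] 1" unfolding parity_def by (auto simp: coeff_pCons split: nat.splits)
lemma parity_ysq: "parity (ysq T) 0" unfolding parity_def ysq_def by (auto simp: coeff_pCons split: nat.splits)
lemma parity_const: "parity [:c:] 0" unfolding parity_def by (auto simp: coeff_pCons split: nat.splits)

lemma parity_poly_neg: assumes "parity p (int a)" shows "poly p (- x) = (-1) ^ a * poly p x"
proof -
  have "poly p (- x) = (\<Sum>i\<le>degree p. coeff p i * (- x) ^ i)" by (simp add: poly_altdef)
  also have "\<dots> = (\<Sum>i\<le>degree p. (-1) ^ a * (coeff p i * x ^ i))"
  proof (rule sum.cong[OF refl])
    fix i
    show "coeff p i * (- x) ^ i = (-1) ^ a * (coeff p i * x ^ i)"
    proof (cases "coeff p i = 0")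
      case False
      then have "even (int i + int a)" using assms by (auto simp: parity_def)
      then have "even (i + a)" by presburger
      then have "(-1 :: complex) ^ i = (-1) ^ a" by (metis neg_one_even_power neg_one_odd_power odd_add)
      then show ?thesis by (simp add: power_minus[of x])
    qed simp
  qed
  also have "\<dots> = (-1) ^ a * poly p x" by (simp add: poly_altdef sum_distrib_left)
  finally show ?thesis .
qed

(* A degree bound allowing negative bounds (then p = 0). *)
definition deg_le :: "complex poly \<Rightarrow> int \<Rightarrow> bool" where
  "deg_le p n \<longleftrightarrow> p = 0 \<or> int (degree p) \<le> n"

lemma deg_le_0[simp]: "deg_le 0 n" by (simp add: deg_le_def)
lemma deg_le_mono: "deg_le p a \<Longrightarrow> a \<le> b \<Longrightarrow> deg_le p b" unfolding deg_le_def by auto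
lemma deg_le_add: assumes "deg_le p a" "deg_le q a" shows "deg_le (p + q) a"
proof -
  have "degree (p + q) \<le> max (degree p) (degree q)" by (rule degree_add_le_max)
  then show ?thesis using assms unfolding deg_le_def
    by (cases "p = 0"; cases "q = 0") auto
qed
lemma deg_le_uminus: "deg_le p a \<Longrightarrow> deg_le (- p) a" unfolding deg_le_def by auto
lemma deg_le_diff: "deg_le p a \<Longrightarrow> deg_le q a \<Longrightarrow> deg_le (p - q) a"
  using deg_le_add[of p a "-q"] deg_le_uminus by auto
lemma deg_le_smult: "deg_le p a \<Longrightarrow> deg_le (smult c p) a" unfolding deg_le_def by auto
lemma deg_le_mult: assumes "deg_le p a" "deg_le q b" shows "deg_le (p * q) (a + b)"
proof (cases "p = 0 \<or> q = 0")
  case False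
  with assms have "int (degree p) \<le> a" "int (degree q) \<le> b" by (auto simp: deg_le_def)
  moreover have "degree (p*q) \<le> degree p + degree q" by (rule degree_mult_le)
  ultimately show ?thesis unfolding deg_le_def by linarith
qed (auto simp: deg_le_def)
lemma deg_le_pderiv: "deg_le p a \<Longrightarrow> deg_le (pderiv p) (a - 1)"
  unfolding deg_le_def
  by (cases "degree p = 0") (auto simp: pderiv_eq_0_iff degree_pderiv)
lemma deg_le_X: "deg_le [:0,1:] 1" by (simp add: deg_le_def)
lemma deg_le_ysq: "deg_le (ysq T) 2" by (simp add: deg_le_def ysq_def)

lemma coeff_deg_le: "deg_le p n \<Longrightarrow> n < int i \<Longrightarrow> coeff p i = 0"
  unfolding deg_le_def by (auto intro: coeff_eq_0)

lemma deg_le_drop_top: assumes "deg_le P (int n)" "coeff P n = 0" shows "deg_le P (int n - 1)"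
proof (cases "P = 0")
  case False
  then have "degree P \<le> n" using assms(1) by (auto simp: deg_le_def)
  moreover have "degree P \<noteq> n" using assms(2) False by (metis leading_coeff_0_iff)
  ultimately show ?thesis by (auto simp: deg_le_def)
qed simp

lemma sum_single:
  assumes "finite A" "a \<in> A" "\<And>b. b \<in> A \<Longrightarrow> b \<noteq> a \<Longrightarrow> f b = 0"
  shows "sum f A = f a"
proof -
  have "sum f A = f a + sum f (A - {a})" using assms by (simp add: sum.remove)
  also have "sum f (A - {a}) = 0" using assms by (intro sum.neutral) auto
  finally show ?thesis by simp
qed

lemma coeff_mult_top:
  assumes "deg_le p (int m)" "deg_le q (int n)"
  shows "coeff (p * q) (m + n) = coeff p m * coeff q n"
proof -
  have "coeff (p * q) (m + n) = (\<Sum>i\<le>m+n. coeff p i * coeff q (m + n - i))" by (simp add: coeff_mult)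
  also have "\<dots> = coeff p m * coeff q (m + n - m)"
  proof (rule sum_single)
    fix i assume "i \<in> {..m+n}" "i \<noteq> m"
    then have "m < i \<or> n < m + n - i" by auto
    then show "coeff p i * coeff q (m + n - i) = 0"
      using coeff_deg_le[OF assms(1)] coeff_deg_le[OF assms(2)] by auto
  qed auto
  finally show ?thesis by simp
qed

(* Weight w: A and B are bounded as if A + x B were a polynomial of degree M - w with
   parity M - w, so that (A + B y)/y^M = O(x^(-w)) at infinity with parity (-1)^w. *)
fun shaped :: "int \<Rightarrow> yfrac \<Rightarrow> bool" where
  "shaped w (A,B,M) \<longleftrightarrow> w \<le> int M \<and> deg_le A (int M - w) \<and> deg_le B (int M - w - 1)
      \<and> parity A (int M - w) \<and> parity B (int M - w + 1)"

(* The coefficient of x^(-w) in the expansion at infinity: that of x^(M-w) in A + x B. *)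
fun top_coeff :: "int \<Rightarrow> yfrac \<Rightarrow> complex" where
  "top_coeff w (A,B,M) = coeff (A + [:0,1:] * B) (nat (int M - w))"

lemma shaped_mult:
  assumes "shaped w1 X" "shaped w2 Y" shows "shaped (w1 + w2) (yf_mult T X Y)"
proof -
  obtain A1 B1 M1 where X: "X = (A1,B1,M1)" by (cases X) auto
  obtain A2 B2 M2 where Y: "Y = (A2,B2,M2)" by (cases Y) auto
  define s1 where "s1 = int M1 - w1"
  define s2 where "s2 = int M2 - w2"
  have h1: "w1 \<le> int M1" "deg_le A1 s1" "deg_le B1 (s1 - 1)" "parity A1 s1" "parity B1 (s1 + 1)"
    using assms(1) by (auto simp: X s1_def)
  have h2: "w2 \<le> int M2" "deg_le A2 s2" "deg_le B2 (s2 - 1)" "parity A2 s2" "parity B2 (s2 + 1)"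
    using assms(2) by (auto simp: Y s2_def)
  have s: "int (M1 + M2) - (w1 + w2) = s1 + s2" by (simp add: s1_def s2_def)
  have d1: "deg_le (A1*A2 + B1*B2*ysq T) (s1 + s2)"
    by (rule deg_le_add[OF deg_le_mult[OF h1(2) h2(2)] deg_le_mono[OF deg_le_mult[OF deg_le_mult[OF h1(3) h2(3)] deg_le_ysq]]]) simp
  have d2: "deg_le (A1*B2 + B1*A2) (s1 + s2 - 1)"
    by (rule deg_le_add[OF deg_le_mono[OF deg_le_mult[OF h1(2) h2(3)]] deg_le_mono[OF deg_le_mult[OF h1(3) h2(2)]]]) simp_all
  have p1: "parity (A1*A2 + B1*B2*ysq T) (s1 + s2)"
    by (rule parity_add[OF parity_mult[OF h1(4) h2(4)] parity_cong[OF parity_mult[OF parity_mult[OF h1(5) h2(5)] parity_ysq]]]) presburger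
  have p2: "parity (A1*B2 + B1*A2) (s1 + s2 + 1)"
    by (rule parity_add[OF parity_cong[OF parity_mult[OF h1(4) h2(5)]] parity_cong[OF parity_mult[OF h1(5) h2(4)]]]) presburger+
  have s': "int M1 + int M2 - (w1 + w2) = s1 + s2" by (simp add: s1_def s2_def)
  show ?thesis using d1 d2 p1 p2 h1(1) h2(1) unfolding X Y by (simp add: s')
qed

lemma shaped_divy: "shaped w X \<Longrightarrow> shaped (w + 1) (yf_divy X)"
  by (cases X) (auto simp: algebra_simps)

lemma shaped_raise: assumes "shaped w X" shows "shaped w (yf_raise T X)"
proof -
  obtain A B M where X: "X = (A,B,M)" by (cases X) auto
  define s where "s = int M - w"
  have h: "w \<le> int M" "deg_le A s" "deg_le B (s - 1)" "parity A s" "parity B (s + 1)"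
    using assms by (auto simp: X s_def)
  have "deg_le (B * ysq T) (s + 1)" by (rule deg_le_mono[OF deg_le_mult[OF h(3) deg_le_ysq]]) simp
  moreover have "parity (B * ysq T) (s + 1)" using parity_mult[OF h(5) parity_ysq] by simp
  moreover have "parity A (s + 1 + 1)" by (rule parity_cong[OF h(4)]) presburger
  ultimately show ?thesis using h unfolding X by (simp add: s_def algebra_simps)
qed

lemma shaped_raise_pow: "shaped w X \<Longrightarrow> shaped w ((yf_raise T ^^ n) X)"
  by (induction n) (auto intro: shaped_raise)

lemma shaped_raise_to: "shaped w X \<Longrightarrow> shaped w (yf_raise_to T m X)" by (simp add: yf_raise_to_def shaped_raise_pow)

lemma shaped_add: assumes "shaped w X" "shaped w Y" "yexp X = yexp Y" shows "shaped w (yf_add X Y)"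
proof -
  obtain A1 B1 M1 where X: "X = (A1,B1,M1)" by (cases X) auto
  obtain A2 B2 M2 where Y: "Y = (A2,B2,M2)" by (cases Y) auto
  show ?thesis using assms unfolding X Y by (auto intro: deg_le_add parity_add)
qed

lemma shaped_smult: "shaped w X \<Longrightarrow> shaped w (yf_smult c X)"
  by (cases X) (auto intro: deg_le_smult parity_smult)

lemma shaped_deriv: assumes "shaped w X" shows "shaped (w + 1) (yf_deriv T X)"
proof -
  obtain A B M where X: "X = (A,B,M)" by (cases X) auto
  define s where "s = int M - w"
  have h: "w \<le> int M" "deg_le A s" "deg_le B (s - 1)" "parity A s" "parity B (s + 1)"
    using assms by (auto simp: X s_def)
  show ?thesis
  proof (cases "M = 0")
    case True
    have "deg_le (pderiv B * ysq T + [:0,1:] * B) s"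
      by (rule deg_le_add[OF deg_le_mono[OF deg_le_mult[OF deg_le_pderiv[OF h(3)] deg_le_ysq]] deg_le_mono[OF deg_le_mult[OF deg_le_X h(3)]]]) simp_all
    moreover have "deg_le (pderiv A) (s - 1)" by (rule deg_le_pderiv[OF h(2)])
    moreover have "parity (pderiv B * ysq T + [:0,1:] * B) s"
      by (rule parity_add[OF parity_cong[OF parity_mult[OF parity_pderiv[OF h(5)] parity_ysq]] parity_cong[OF parity_mult[OF parity_X h(5)]]]) presburger+
    moreover have "parity (pderiv A) (s + 1)" by (rule parity_pderiv[OF h(4)])
    ultimately show ?thesis using h True unfolding X by (simp add: s_def algebra_simps)
  next
    case False
    have "deg_le (pderiv A * ysq T - smult (of_nat M) ([:0,1:] * A)) (s + 1)"
      by (rule deg_le_diff[OF deg_le_mono[OF deg_le_mult[OF deg_le_pderiv[OF h(2)] deg_le_ysq]] deg_le_smult[OF deg_le_mono[OF deg_le_mult[OF deg_le_X h(2)]]]]) simp_all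
    moreover have "deg_le (pderiv B * ysq T + [:0,1:] * B - smult (of_nat M) ([:0,1:] * B)) s"
      by (rule deg_le_diff[OF deg_le_add[OF deg_le_mono[OF deg_le_mult[OF deg_le_pderiv[OF h(3)] deg_le_ysq]] deg_le_mono[OF deg_le_mult[OF deg_le_X h(3)]]] deg_le_smult[OF deg_le_mono[OF deg_le_mult[OF deg_le_X h(3)]]]]) simp_all
    moreover have "parity (pderiv A * ysq T - smult (of_nat M) ([:0,1:] * A)) (s + 1)"
      by (rule parity_diff[OF parity_cong[OF parity_mult[OF parity_pderiv[OF h(4)] parity_ysq]] parity_smult[OF parity_cong[OF parity_mult[OF parity_X h(4)]]]]) presburger+
    moreover have "parity (pderiv B * ysq T + [:0,1:] * B - smult (of_nat M) ([:0,1:] * B)) (s + 2)"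
      by (rule parity_diff[OF parity_add[OF parity_cong[OF parity_mult[OF parity_pderiv[OF h(5)] parity_ysq]] parity_cong[OF parity_mult[OF parity_X h(5)]]] parity_smult[OF parity_cong[OF parity_mult[OF parity_X h(5)]]]]) presburger+
    ultimately show ?thesis using h False unfolding X by (simp add: s_def algebra_simps)
  qed
qed

lemma shaped_sum: "(\<And>X. X \<in> set xs \<Longrightarrow> shaped w X \<and> yexp X \<le> m) \<Longrightarrow> w \<le> int m \<Longrightarrow> shaped w (yf_sum T m xs)"
proof (induction xs)
  case Nil then show ?case by (simp add: yf_sum_nil)
next
  case (Cons X xs)
  then show ?case unfolding yf_sum_cons
    by (intro shaped_add shaped_raise_to) (auto simp: yexp_raise_to yexp_sum)
qed

lemma top_coeff_mult: assumes "shaped w1 X" "shaped w2 Y" shows "top_coeff (w1 + w2) (yf_mult T X Y) = top_coeff w1 X * top_coeff w2 Y"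
proof -
  obtain A1 B1 M1 where X: "X = (A1,B1,M1)" by (cases X) auto
  obtain A2 B2 M2 where Y: "Y = (A2,B2,M2)" by (cases Y) auto
  define s1 where "s1 = int M1 - w1"
  define s2 where "s2 = int M2 - w2"
  have h1: "w1 \<le> int M1" "deg_le A1 s1" "deg_le B1 (s1 - 1)"
    using assms(1) by (auto simp: X s1_def)
  have h2: "w2 \<le> int M2" "deg_le A2 s2" "deg_le B2 (s2 - 1)"
    using assms(2) by (auto simp: Y s2_def)
  define n1 where "n1 = nat s1"
  define n2 where "n2 = nat s2"
  have n: "s1 = int n1" "s2 = int n2" using h1(1) h2(1) by (auto simp: n1_def n2_def s1_def s2_def)
  have e: "A1 * A2 + B1 * B2 * ysq T + [:0,1:] * (A1 * B2 + B1 * A2)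
       = (A1 + [:0,1:] * B1) * (A2 + [:0,1:] * B2) - smult (4 * complex_of_real T) (B1 * B2)"
    by (simp add: ysq_eq algebra_simps)
  have P1: "deg_le (A1 + [:0,1:] * B1) (int n1)"
    using deg_le_add[OF h1(2) deg_le_mono[OF deg_le_mult[OF deg_le_X h1(3)]]] n by simp
  have P2: "deg_le (A2 + [:0,1:] * B2) (int n2)"
    using deg_le_add[OF h2(2) deg_le_mono[OF deg_le_mult[OF deg_le_X h2(3)]]] n by simp
  have B: "coeff (B1 * B2) (n1 + n2) = 0"
    by (rule coeff_deg_le[OF deg_le_mult[OF h1(3) h2(3)]]) (use n in simp)
  have idx: "nat (int (M1 + M2) - (w1 + w2)) = n1 + n2" using n by (simp add: s1_def s2_def)
  show ?thesis unfolding X Y using n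
    by (simp only: yf_mult.simps top_coeff.simps idx e coeff_diff coeff_smult B coeff_mult_top[OF P1 P2])
       (simp add: s1_def s2_def)
qed

lemma top_coeff_divy: "top_coeff (w + 1) (yf_divy X) = top_coeff w X" by (cases X) (simp add: algebra_simps)

lemma top_coeff_raise: assumes "shaped w X" shows "top_coeff w (yf_raise T X) = top_coeff w X"
proof -
  obtain A B M where X: "X = (A,B,M)" by (cases X) auto
  define s where "s = int M - w"
  have h: "w \<le> int M" "deg_le A s" "deg_le B (s - 1)" using assms by (auto simp: X s_def)
  define n where "n = nat s"
  have ns: "s = int n" using h(1) by (simp add: n_def s_def)
  have e: "B * ysq T + [:0,1:] * A = [:0,1:] * (A + [:0,1:] * B) - smult (4 * complex_of_real T) B"
    by (simp add: ysq_eq algebra_simps)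
  have idx: "nat (int (Suc M) - w) = Suc n" using ns by (simp add: s_def)
  have idx2: "nat (int M - w) = n" using ns by (simp add: s_def)
  have "coeff B (Suc n) = 0" by (rule coeff_deg_le[OF h(3)]) (simp add: ns)
  then show ?thesis unfolding X yf_raise.simps top_coeff.simps idx idx2 e
    by (simp add: coeff_diff coeff_pCons_Suc)
qed
  
lemma top_coeff_raise_pow: "shaped w X \<Longrightarrow> top_coeff w ((yf_raise T ^^ n) X) = top_coeff w X"
  by (induction n) (auto simp: top_coeff_raise shaped_raise_pow)
lemma top_coeff_raise_to: "shaped w X \<Longrightarrow> top_coeff w (yf_raise_to T m X) = top_coeff w X"
  by (simp add: yf_raise_to_def top_coeff_raise_pow)

lemma top_coeff_add: "yexp X = yexp Y \<Longrightarrow> top_coeff w (yf_add X Y) = top_coeff w X + top_coeff w Y"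
  by (cases X; cases Y) (simp add: algebra_simps coeff_pCons split: nat.split)
lemma top_coeff_smult: "top_coeff w (yf_smult c X) = c * top_coeff w X" by (cases X) (simp add: algebra_simps coeff_pCons split: nat.split)

lemma top_coeff_sum: "(\<And>X. X \<in> set xs \<Longrightarrow> shaped w X \<and> yexp X \<le> m) \<Longrightarrow> top_coeff w (yf_sum T m xs) = (\<Sum>X\<leftarrow>xs. top_coeff w X)"
proof (induction xs)
  case Nil then show ?case by (simp add: yf_sum_nil)
next
  case (Cons X xs)
  then show ?case unfolding yf_sum_cons
    by (subst top_coeff_add) (auto simp: yexp_raise_to yexp_sum top_coeff_raise_to)
qed

lemma yf_deriv_top_poly:
  assumes "yf_deriv T (A,B,M) = (A',B',M')"
  shows "A' + [:0,1:] * B' = (if M = 0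
           then [:0,1:] * pderiv (A + [:0,1:] * B) - smult (4 * complex_of_real T) (pderiv B)
           else ysq T * pderiv (A + [:0,1:] * B) + smult (4 * complex_of_real T) B
                - smult (of_nat M) ([:0,1:] * (A + [:0,1:] * B)))"
proof -
  have pdP: "pderiv (A + [:0,1:] * B) = pderiv A + B + [:0,1:] * pderiv B"
    by (simp add: pderiv_add pderiv_mult pderiv_pCons algebra_simps)
  have e: "\<And>X C K :: complex poly. pderiv A * (X*X - C) - K*(X*A) + X*(pderiv B*(X*X - C) + X*B - K*(X*B))
      = (X*X - C)*(pderiv A + B + X*pderiv B) + C*B - K*(X*(A + X*B))"
    by (simp add: algebra_simps)
  show ?thesis
  proof (cases "M = 0")
    case True
    then have a: "A' = pderiv B * ysq T + [:0,1:] * B" and b: "B' = pderiv A" using assms by auto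
    show ?thesis unfolding a b pdP using True by (simp add: ysq_eq algebra_simps)
  next
    case False
    then have a: "A' = pderiv A * ysq T - smult (of_nat M) ([:0,1:] * A)"
      and b: "B' = pderiv B * ysq T + [:0,1:] * B - smult (of_nat M) ([:0,1:] * B)" using assms by auto
    show ?thesis using False e[of "[:0,1:]" "[:4 * complex_of_real T:]" "[:of_nat M:]"]
      unfolding a b pdP ysq_eq by simp
  qed
qed

lemma top_coeff_deriv: assumes "shaped w X" "top_coeff w X = 0" shows "top_coeff (w + 1) (yf_deriv T X) = 0"
proof -
  obtain A B M where X: "X = (A,B,M)" by (cases X) auto
  obtain A' B' M' where D: "yf_deriv T X = (A',B',M')" by (cases "yf_deriv T X") auto
  define n where "n = nat (int M - w)"
  have h: "deg_le A (int n)" "deg_le B (int n - 1)" and ns: "int n = int M - w"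
    using assms(1) by (auto simp: X n_def)
  define P where "P = A + [:0,1:] * B"
  have "deg_le P (int n)" unfolding P_def using deg_le_add[OF h(1) deg_le_mono[OF deg_le_mult[OF deg_le_X h(2)]]] by simp
  moreover have "coeff P n = 0" using assms(2) by (simp add: X P_def n_def)
  ultimately have dP: "deg_le P (int n - 1)" by (rule deg_le_drop_top)
  note top = yf_deriv_top_poly[OF D[unfolded X], folded P_def]
  show ?thesis
  proof (cases "M = 0")
    case True
    have "deg_le ([:0,1:] * pderiv P - smult (4 * complex_of_real T) (pderiv B)) (int n - 1)"
      by (rule deg_le_diff[OF deg_le_mono[OF deg_le_mult[OF deg_le_X deg_le_pderiv[OF dP]]] deg_le_smult[OF deg_le_mono[OF deg_le_pderiv[OF h(2)]]]]) simp_all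
    then have d: "deg_le (A' + [:0,1:] * B') (int n - 1)" using top True by simp
    have "coeff (A' + [:0,1:] * B') n = 0" by (rule coeff_deg_le[OF d]) simp
    moreover have "nat (int M' - (w + 1)) = n" using True D ns by (auto simp: X)
    ultimately show ?thesis unfolding D top_coeff.simps by simp
  next
    case False
    have "deg_le (ysq T * pderiv P + smult (4 * complex_of_real T) B - smult (of_nat M) ([:0,1:] * P)) (int n)"
      by (rule deg_le_diff[OF deg_le_add[OF deg_le_mono[OF deg_le_mult[OF deg_le_ysq deg_le_pderiv[OF dP]]] deg_le_smult[OF deg_le_mono[OF h(2)]]] deg_le_smult[OF deg_le_mono[OF deg_le_mult[OF deg_le_X dP]]]]) simp_all
    then have d: "deg_le (A' + [:0,1:] * B') (int n)" using top False by simp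
    have "coeff (A' + [:0,1:] * B') (Suc n) = 0" by (rule coeff_deg_le[OF d]) simp
    moreover have "nat (int M' - (w + 1)) = Suc n" using False D ns assms(1) by (auto simp: X)
    ultimately show ?thesis unfolding D top_coeff.simps by simp
  qed
qed

(* tame w X: weight w and top coefficient 0, i.e. the function is O(x^(-w-1)). All the
   coefficients computed below are tame. *)
definition tame :: "int \<Rightarrow> yfrac \<Rightarrow> bool" where
  "tame w X \<longleftrightarrow> shaped w X \<and> top_coeff w X = 0"

lemma tame_mult_left: "tame w1 X \<Longrightarrow> shaped w2 Y \<Longrightarrow> tame (w1 + w2) (yf_mult T X Y)"
  unfolding tame_def by (simp add: shaped_mult top_coeff_mult)

lemma tame_mult_right: "shaped w1 X \<Longrightarrow> tame w2 Y \<Longrightarrow> tame (w1 + w2) (yf_mult T X Y)"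
  unfolding tame_def by (simp add: shaped_mult top_coeff_mult)

lemma tame_deriv: "tame w X \<Longrightarrow> tame (w + 1) (yf_deriv T X)"
  unfolding tame_def by (simp add: shaped_deriv top_coeff_deriv)

lemma tame_divy: "tame w X \<Longrightarrow> tame (w + 1) (yf_divy X)"
  unfolding tame_def by (simp add: shaped_divy top_coeff_divy)

lemma tame_smult: "tame w X \<Longrightarrow> tame w (yf_smult c X)"
  unfolding tame_def by (simp add: shaped_smult top_coeff_smult)

lemma tame_sum:
  assumes "\<And>X. X \<in> set xs \<Longrightarrow> tame w X \<and> yexp X \<le> m" and "w \<le> int m"
  shows "tame w (yf_sum T m xs) \<and> yexp (yf_sum T m xs) = m"
proof (intro conjI)
  have "top_coeff w (yf_sum T m xs) = (\<Sum>X\<leftarrow>xs. top_coeff w X)"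
    by (rule top_coeff_sum) (use assms in \<open>auto simp: tame_def\<close>)
  also have "\<dots> = 0" using assms(1) by (induction xs) (auto simp: tame_def)
  finally show "tame w (yf_sum T m xs)" unfolding tame_def
    using shaped_sum[of xs w m T] assms by (auto simp: tame_def)
  show "yexp (yf_sum T m xs) = m" by (rule yexp_sum) (use assms in auto)
qed

section \<open>Evaluation of y-fractions\<close>

fun yf_eval :: "real \<Rightarrow> yfrac \<Rightarrow> complex \<Rightarrow> complex" where
  "yf_eval T (A,B,M) x = (poly A x + poly B x * ybr T x) / ybr T x ^ M"

context fixes T :: real and x :: complex assumes T: "0 < T" and x: "x \<in> Ucut T"
begin

lemma poly_ysq_ybr: "poly (ysq T) x = ybr T x ^ 2" using ybr_sq[OF T x] by simp

lemma yf_eval_mult: "yf_eval T (yf_mult T X Y) x = yf_eval T X x * yf_eval T Y x"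
proof -
  obtain A1 B1 M1 where X: "X = (A1,B1,M1)" by (cases X) auto
  obtain A2 B2 M2 where Y: "Y = (A2,B2,M2)" by (cases Y) auto
  have y0: "ybr T x \<noteq> 0" using ybr_nonzero[OF T x] .
  show ?thesis unfolding X Y using y0
    by (simp del: poly_ysq add: poly_ysq_ybr power_add field_simps power2_eq_square)
qed

lemma yf_eval_divy: "yf_eval T (yf_divy X) x = yf_eval T X x / ybr T x"
  using ybr_nonzero[OF T x] by (cases X) (simp add: field_simps)

lemma yf_eval_raise: "yf_eval T (yf_raise T X) x = yf_eval T X x"
proof -
  obtain A B M where X: "X = (A,B,M)" by (cases X) auto
  have y0: "ybr T x \<noteq> 0" using ybr_nonzero[OF T x] .
  show ?thesis unfolding X using y0 by (simp del: poly_ysq add: poly_ysq_ybr field_simps power2_eq_square)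
qed

lemma yf_eval_raise_pow: "yf_eval T ((yf_raise T ^^ n) X) x = yf_eval T X x"
  by (induction n) (auto simp: yf_eval_raise)
lemma yf_eval_raise_to: "yf_eval T (yf_raise_to T m X) x = yf_eval T X x"
  by (simp add: yf_raise_to_def yf_eval_raise_pow)
lemma yf_eval_add: "yexp X = yexp Y \<Longrightarrow> yf_eval T (yf_add X Y) x = yf_eval T X x + yf_eval T Y x"
  by (cases X; cases Y) (simp add: field_simps add_divide_distrib)
lemma yf_eval_smult: "yf_eval T (yf_smult c X) x = c * yf_eval T X x"
  by (cases X) (simp add: field_simps)
lemma yf_eval_sum: "(\<And>X. X \<in> set xs \<Longrightarrow> yexp X \<le> m) \<Longrightarrow> yf_eval T (yf_sum T m xs) x = (\<Sum>X\<leftarrow>xs. yf_eval T X x)"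
proof (induction xs)
  case Nil then show ?case by (simp add: yf_sum_nil)
next
  case (Cons X xs)
  then show ?case unfolding yf_sum_cons
    by (subst yf_eval_add) (auto simp: yexp_raise_to yexp_sum yf_eval_raise_to)
qed

lemma yf_eval_deriv: "(yf_eval T X has_field_derivative yf_eval T (yf_deriv T X) x) (at x)"
proof -
  obtain A B M where X: "X = (A,B,M)" by (cases X) auto
  define y where "y = ybr T x"
  have y0: "y \<noteq> 0" using ybr_nonzero[OF T x] by (simp add: y_def)
  have dy: "(ybr T has_field_derivative x / y) (at x)" using ybr_deriv[OF T x] by (simp add: y_def)
  have dN: "((\<lambda>t. poly A t + poly B t * ybr T t) has_field_derivative
      (poly (pderiv A) x + (poly (pderiv B) x * y + poly B x * (x / y)))) (at x)"
    using DERIV_add[OF poly_DERIV[of A x] DERIV_mult[OF poly_DERIV[of B x] ybr_deriv[OF T x]]]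
    by (simp add: y_def mult.commute)
  have dq: "((\<lambda>t. ybr T t ^ M) has_field_derivative (of_nat M * y ^ (M - 1) * (x / y))) (at x)"
    using DERIV_power[OF ybr_deriv[OF T x], of M] by (simp add: y_def mult_ac)
  have d: "((\<lambda>t. (poly A t + poly B t * ybr T t) / ybr T t ^ M) has_field_derivative
     ((poly (pderiv A) x + (poly (pderiv B) x * y + poly B x * (x / y))) * y ^ M
       - (poly A x + poly B x * y) * (of_nat M * y ^ (M - 1) * (x / y))) / (y ^ M * y ^ M)) (at x)"
    using DERIV_divide[OF dN dq] y0 by (simp add: y_def)
  have Y2': "poly (ysq T) x = y ^ 2" using poly_ysq_ybr by (simp add: y_def)
  have eq: "((poly (pderiv A) x + (poly (pderiv B) x * y + poly B x * (x / y))) * y ^ M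
       - (poly A x + poly B x * y) * (of_nat M * y ^ (M - 1) * (x / y))) / (y ^ M * y ^ M)
      = yf_eval T (yf_deriv T X) x"
  proof (cases M)
    case 0
    then show ?thesis unfolding X using y0
      by (simp del: poly_ysq add: Y2' y_def[symmetric] field_simps power2_eq_square)
  next
    case (Suc m)
    then show ?thesis unfolding X using y0
      by (simp del: poly_ysq add: Y2' y_def[symmetric] field_simps power2_eq_square)
  qed
  have "yf_eval T X = (\<lambda>t. (poly A t + poly B t * ybr T t) / ybr T t ^ M)" by (simp add: X fun_eq_iff)
  with d eq show ?thesis by simp
qed

end

lemma deriv_eq_yf_eval:
  assumes T: "0 < T" and x: "x \<in> Ucut T" and f: "\<And>t. t \<in> Ucut T \<Longrightarrow> f t = yf_eval T X t"
  shows "deriv f x = yf_eval T (yf_deriv T X) x"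
proof -
  have "eventually (\<lambda>t. f t = yf_eval T X t) (nhds x)"
    using open_Ucut x f by (auto simp: eventually_nhds)
  then have "deriv f x = deriv (yf_eval T X) x" by (rule deriv_cong_ev) simp
  also have "\<dots> = yf_eval T (yf_deriv T X) x" by (rule DERIV_imp_deriv[OF yf_eval_deriv[OF T x]])
  finally show ?thesis .
qed


section \<open>Iterated derivatives and Taylor difference quotients\<close>

abbreviation yf_derivs :: "real \<Rightarrow> nat \<Rightarrow> yfrac \<Rightarrow> yfrac" where "yf_derivs T k \<equiv> yf_deriv T ^^ k"

lemma yf_derivs_deriv: "yf_derivs T k (yf_deriv T F) = yf_derivs T (Suc k) F"
  by (simp add: funpow_Suc_right del: funpow.simps)

lemma tame_derivs: "tame w F \<Longrightarrow> tame (w + int k) (yf_derivs T k F)"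
proof (induction k)
  case (Suc k)
  have "tame (w + int k + 1) (yf_deriv T (yf_derivs T k F))" by (rule tame_deriv[OF Suc.IH[OF Suc.prems]])
  then show ?case by (simp add: algebra_simps)
qed simp

lemma yexp_derivs: "yexp (yf_derivs T k F) \<le> yexp F + 2 * k"
proof (induction k)
  case (Suc k) then show ?case using yexp_deriv_le[of T "yf_derivs T k F"] by simp
qed simp

(* tquot T F k x z = (f(x) - sum_{i<k} f^(i)(z) (x-z)^i/i!) / (x-z)^k for f = yf_eval T F:
   the Taylor difference quotients arising from the nonlocal term of the loop equation
   for W_2 (see tquot_closed). *)
fun tquot :: "real \<Rightarrow> yfrac \<Rightarrow> nat \<Rightarrow> complex \<Rightarrow> complex \<Rightarrow> complex" where
  "tquot T F 0 x z = yf_eval T F x"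
| "tquot T F (Suc k) x z = (tquot T F k x z - yf_eval T (yf_derivs T k F) z / fact k) / (x - z)"

lemma tquot_deriv_identity:
  fixes b u v d K :: complex
  assumes "d \<noteq> 0" "K + 1 \<noteq> 0"
  shows "((b - K * u) * d - (u * d) * 1) / (d * d) = (b - v) / d - (K + 1) * ((u - v / (K + 1)) / d)"
proof -
  have a: "(K + 1) * v / (K + 1) = v" using assms by simp
  have b: "(K + 1) * ((u - v / (K + 1)) / d) = ((K + 1) * u - v) / d"
    by (simp only: times_divide_eq_right right_diff_distrib a)
  show ?thesis unfolding b using assms by (simp add: field_simps)
qed

lemma tquot_deriv:
  assumes T: "0 < T" and x: "x \<in> Ucut T" and xz: "x \<noteq> z"
  shows "((\<lambda>t. tquot T F k t z) has_field_derivative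
           (tquot T (yf_deriv T F) k x z - of_nat k * tquot T F (Suc k) x z)) (at x)"
proof (induction k arbitrary: F)
  case 0
  then show ?case using yf_eval_deriv[OF T x] by simp
next
  case (Suc k)
  define c where "c = yf_eval T (yf_derivs T k F) z / fact k"
  have d: "((\<lambda>t. (tquot T F k t z - c) / (t - z)) has_field_derivative
      ((tquot T (yf_deriv T F) k x z - of_nat k * tquot T F (Suc k) x z) * (x - z) - (tquot T F k x z - c) * 1) / ((x - z) * (x - z))) (at x)"
    using DERIV_divide[OF DERIV_diff[OF Suc.IH DERIV_const[of c]] DERIV_diff[OF DERIV_ident DERIV_const[of z]]] xz
    by simp
  have e: "((tquot T (yf_deriv T F) k x z - of_nat k * tquot T F (Suc k) x z) * (x - z) - (tquot T F k x z - c) * 1) / ((x - z) * (x - z))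
     = tquot T (yf_deriv T F) (Suc k) x z - of_nat (Suc k) * tquot T F (Suc (Suc k)) x z"
  proof -
    have K: "of_nat k + 1 \<noteq> (0::complex)" using of_nat_neq_0[of k, where 'a=complex] by (simp add: add.commute)
    have "((tquot T (yf_deriv T F) k x z - of_nat k * ((tquot T F k x z - c) / (x - z))) * (x - z) - (tquot T F k x z - c) * 1) / ((x - z) * (x - z))
      = (tquot T (yf_deriv T F) k x z - yf_eval T (yf_derivs T (Suc k) F) z / fact k) / (x - z)
        - (of_nat k + 1) * (((tquot T F k x z - c) / (x - z) - yf_eval T (yf_derivs T (Suc k) F) z / ((of_nat k + 1) * fact k)) / (x - z))"
      using tquot_deriv_identity[of "x - z" "of_nat k" "tquot T (yf_deriv T F) k x z" "(tquot T F k x z - c) / (x - z)" "yf_eval T (yf_derivs T (Suc k) F) z / fact k"] xz K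
      by (simp add: mult.commute)
    then show ?thesis by (simp add: c_def yf_derivs_deriv algebra_simps)
  qed
  show ?case using d unfolding e by (simp add: c_def)
qed

lemma tquot_closed:
  assumes "x \<noteq> z"
  shows "tquot T F k x z = (yf_eval T F x - (\<Sum>i<k. yf_eval T (yf_derivs T i F) z * (x - z) ^ i / fact i)) / (x - z) ^ k"
proof (induction k)
  case 0 then show ?case by simp
next
  case (Suc k)
  have xz: "x - z \<noteq> 0" using assms by simp
  show ?case by (simp only: tquot.simps Suc.IH) (use xz in \<open>simp add: field_simps\<close>)
qed

lemma tquot_bound:
  assumes T: "0 < T" and S: "convex S" "S \<subseteq> Ucut T" and x: "x \<in> S" and z: "z \<in> S" "z \<noteq> x"
    and B: "\<And>t. t \<in> S \<Longrightarrow> cmod (yf_eval T (yf_derivs T (Suc k) F) t) \<le> B"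
  shows "cmod (tquot T F k x z - yf_eval T (yf_derivs T k F) z / fact k) \<le> B * cmod (x - z) / fact k"
proof -
  define f where "f = (\<lambda>i. yf_eval T (yf_derivs T i F))"
  have fd: "(f i has_field_derivative f (Suc i) t) (at t within S)" if "t \<in> S" for i t
    using yf_eval_deriv[OF T, of t "yf_derivs T i F"] that S(2)
    by (auto simp: f_def has_field_derivative_at_within)
  have fB: "cmod (f (Suc k) t) \<le> B" if "t \<in> S" for t using B[OF that] by (simp add: f_def)
  have tay: "cmod (f 0 x - (\<Sum>i\<le>k. f i z * (x - z) ^ i / fact i)) \<le> B * cmod (x - z) ^ Suc k / fact k"
    by (rule complex_Taylor[of S k f B z x]) (use fd fB S(1) x z in auto)
  have xz: "x - z \<noteq> 0" using z by simp
  have "tquot T F k x z - f k z / fact k = (f 0 x - (\<Sum>i\<le>k. f i z * (x - z) ^ i / fact i)) / (x - z) ^ k"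
    using xz by (simp add: tquot_closed lessThan_Suc_atMost[symmetric] f_def field_simps)
  then have "cmod (tquot T F k x z - f k z / fact k)
      = cmod (f 0 x - (\<Sum>i\<le>k. f i z * (x - z) ^ i / fact i)) / cmod (x - z) ^ k"
    by (simp add: norm_divide norm_power)
  also have "\<dots> \<le> (B * cmod (x - z) ^ Suc k / fact k) / cmod (x - z) ^ k"
    by (rule divide_right_mono[OF tay]) simp
  also have "\<dots> = B * cmod (x - z) / fact k" using xz by (simp add: field_simps)
  finally show ?thesis unfolding f_def .
qed

lemma tquot_lim:
  assumes T: "0 < T" and x: "x \<in> Ucut T"
  shows "((\<lambda>z. tquot T F k x z) \<longlongrightarrow> yf_eval T (yf_derivs T k F) x / fact k) (at x)"
proof -
  obtain r where r: "0 < r" "cball x r \<subseteq> Ucut T"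
    using open_Ucut[unfolded open_contains_cball] x by blast
  define S where "S = cball x r"
  define f where "f = (\<lambda>i. yf_eval T (yf_derivs T i F))"
  have fd: "(f i has_field_derivative f (Suc i) t) (at t within S)" if "t \<in> S" for i t
  proof -
    have "t \<in> Ucut T" using that r by (auto simp: S_def)
    from yf_eval_deriv[OF T this, of "yf_derivs T i F"]
    show ?thesis by (simp add: f_def has_field_derivative_at_within)
  qed
  have "continuous_on S (f (Suc k))" by (rule DERIV_continuous_on[OF fd])
  then have "bounded (f (Suc k) ` S)"
    by (intro compact_imp_bounded compact_continuous_image) (simp_all add: S_def)
  then obtain B where B: "\<forall>y\<in>f (Suc k) ` S. norm y \<le> B" unfolding bounded_iff by blast
  have "cmod (tquot T F k x z - f k z / fact k) \<le> B * cmod (x - z) / fact k"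
    if "z \<in> S" "z \<noteq> x" for z
    unfolding f_def using B r that
    by (intro tquot_bound[OF T convex_cball[of x r]]) (auto simp: S_def f_def)
  then have near: "eventually (\<lambda>z. cmod (tquot T F k x z - f k z / fact k) \<le> B * cmod (x - z) / fact k) (at x)"
    unfolding eventually_at using r(1) by (intro exI[of _ r]) (auto simp: S_def dist_commute)
  have "((\<lambda>z. B * cmod (x - z) / fact k) \<longlongrightarrow> B * cmod (x - x) / fact k) (at x)"
    by (intro tendsto_intros) simp
  then have "((\<lambda>z. tquot T F k x z - f k z / fact k) \<longlongrightarrow> 0) (at x)"
    by (intro Lim_null_comparison[OF near]) simp
  moreover have "((\<lambda>z. f k z / fact k) \<longlongrightarrow> f k x / fact k) (at x)"
  proof -
    have "isCont (f k) x" unfolding f_def using yf_eval_deriv[OF T x] by (rule DERIV_isCont)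
    then show ?thesis unfolding isCont_def by (rule tendsto_divide[OF _ tendsto_const]) simp
  qed
  ultimately have "((\<lambda>z. (tquot T F k x z - f k z / fact k) + f k z / fact k) \<longlongrightarrow> 0 + f k x / fact k) (at x)"
    by (rule tendsto_add)
  then show ?thesis by (simp add: f_def)
qed

lemma deriv_diff_quot:
  assumes T: "0 < T" and x: "x \<in> Ucut T" and z: "z \<in> Ucut T" and xz: "x \<noteq> z"
      and f: "\<And>t. t \<in> Ucut T \<Longrightarrow> f t = yf_eval T F t"
  shows "deriv (\<lambda>t. (f x - f t) / (x - t)) z = tquot T F 2 x z"
proof -
  have "eventually (\<lambda>t. (f x - f t) / (x - t) = (yf_eval T F x - yf_eval T F t) / (x - t)) (nhds z)"
    using open_Ucut z f x by (auto simp: eventually_nhds)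
  then have "deriv (\<lambda>t. (f x - f t) / (x - t)) z = deriv (\<lambda>t. (yf_eval T F x - yf_eval T F t) / (x - t)) z"
    by (rule deriv_cong_ev) simp
  also have "\<dots> = ((0 - yf_eval T (yf_deriv T F) z) * (x - z) - (yf_eval T F x - yf_eval T F z) * (0 - 1)) / ((x - z) * (x - z))"
    by (rule DERIV_imp_deriv, rule DERIV_divide[OF DERIV_diff[OF DERIV_const yf_eval_deriv[OF T z]] DERIV_diff[OF DERIV_const DERIV_ident]])
       (use xz in simp)
  also have "\<dots> = tquot T F 2 x z" using xz by (simp add: numeral_2_eq_2 field_simps)
  finally show ?thesis .
qed


section \<open>The loop equations and the vanishing of excluded coefficients\<close>

definition loop_rhs :: "real \<Rightarrow> (nat \<Rightarrow> nat \<Rightarrow> nat \<Rightarrow> complex list \<Rightarrow> complex) \<Rightarrow> nat \<Rightarrow> nat \<Rightarrow> nat \<Rightarrow> complex \<Rightarrow> complex list \<Rightarrow> complex" where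
 "loop_rhs T W g n j x I =
          (if 1 \<le> g \<and> 1 \<le> j then deriv (\<lambda>t. W (g - 1) n (j - 1) (t # I)) x else 0)
        + (if 2 \<le> g then W (g - 2) (n + 1) j (x # x # I) else 0)
        + (\<Sum>S \<in> Pow {..<n-1}. \<Sum>p \<in> {0..g}.
             if (S = {} \<and> p = 0) \<or> (S = {..<n-1} \<and> p = g) then 0
             else (\<Sum>a \<in> {0..j}. W p (card S + 1) a (x # nths I S)
                    * W (g - p) (n - card S) (j - a) (x # nths I ({..<n-1} - S))))
        + (\<Sum>i < n - 1. deriv (\<lambda>t. (W g (n - 1) j (x # nths I ({..<n-1} - {i}))
                                   - W g (n - 1) j (I[i := t])) / (x - t)) (I ! i))"

lemma loop_base: assumes "loop_family T W" "x \<in> Ucut T" shows "W 0 1 0 [x] = (x - ybr T x) / 2"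
proof -
  note H = assms(1)[unfolded loop_family_def, THEN conjunct1]
  show ?thesis using H assms(2) by blast
qed
lemma loop_base_vanish: assumes "loop_family T W" "x \<in> Ucut T" "1 \<le> j" shows "W 0 1 j [x] = 0"
proof -
  note H = assms(1)[unfolded loop_family_def, THEN conjunct1]
  show ?thesis using H assms(2,3) by blast
qed
lemma loop_diag_lim: assumes "loop_family T W" "2 \<le> m" "x \<in> Ucut T" "length I = m - 2" "set I \<subseteq> Ucut T"
        "distinct (x # I)" shows "((\<lambda>z. W g m j (x # z # I)) \<longlongrightarrow> W g m j (x # x # I)) (at x)"
proof -
  note H = assms(1)[unfolded loop_family_def, THEN conjunct2, THEN conjunct1]
  show ?thesis by (rule H[rule_format]) (rule assms)+
qed
lemma loop_eq: assumes "loop_family T W" "1 \<le> n" "(n, g) \<noteq> (1, 0)" "x \<in> Ucut T"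
        "length I = n - 1" "set I \<subseteq> Ucut T" "distinct (x # I)"
      shows "ybr T x * W g n j (x # I) = loop_rhs T W g n j x I"
proof -
  note H = assms(1)[unfolded loop_family_def, THEN conjunct2, THEN conjunct2]
  show ?thesis unfolding loop_rhs_def by (rule H[rule_format]) (rule assms)+
qed

lemma deriv_zero_near:
  assumes "open U" "x \<in> U" "\<And>t. t \<in> U \<Longrightarrow> f t = 0"
  shows "deriv f x = 0"
proof -
  have "eventually (\<lambda>t. f t = (\<lambda>_. 0) t) (nhds x)" using assms by (auto simp: eventually_nhds)
  then have "deriv f x = deriv (\<lambda>_. 0) x" by (rule deriv_cong_ev) simp
  then show ?thesis by simp
qed

lemma lim_zero_near:
  fixes x :: complex
  assumes "(f \<longlongrightarrow> L) (at x)" "open U" "x \<in> U" "\<And>t. t \<in> U \<Longrightarrow> t \<noteq> x \<Longrightarrow> f t = 0"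
  shows "L = (0::complex)"
proof -
  have "eventually (\<lambda>t. f t = 0) (at x)"
    using assms(2-4) unfolding eventually_at_topological by blast
  then have "(f \<longlongrightarrow> 0) (at x)" by (rule tendsto_eventually)
  with assms(1) show ?thesis by (rule tendsto_unique[rotated]) simp
qed

lemma open_minus_finite: "open U \<Longrightarrow> finite F \<Longrightarrow> open (U - (F::complex set))"
  by (simp add: open_Diff finite_imp_closed)

lemma nths_points:
  assumes "S \<subseteq> {..<length I}" "set I \<subseteq> U" "distinct (x # I)"
  shows "length (nths I S) = card S" "set (nths I S) \<subseteq> U" "distinct (x # nths I S)"
proof -
  have "{i. i < length I \<and> i \<in> S} = S" using assms(1) by auto
  then show "length (nths I S) = card S" by (simp add: length_nths)
  show "set (nths I S) \<subseteq> U" "distinct (x # nths I S)"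
    using assms(2,3) set_nths_subset[of I S] by auto
qed

(* The coefficient of hbar^j in W_n^(g) is excluded if j > g or j differs from g in parity;
   exclusion is inherited by one of the two factors of every product term. *)
definition excluded :: "nat \<Rightarrow> nat \<Rightarrow> bool" where "excluded g j \<longleftrightarrow> g < j \<or> odd (g + j)"

lemma excluded_split: "excluded g j \<Longrightarrow> a \<le> j \<Longrightarrow> p \<le> g \<Longrightarrow> excluded p a \<or> excluded (g - p) (j - a)"
  unfolding excluded_def by presburger

(* Product terms with factors supported on non-excluded coefficients: at the top order
   N = p + q only a = p contributes, at the subleading order N = p + q - 2 only a = p and
   a = p - 2 do. *)
lemma convolution_top:
  fixes f h :: "nat \<Rightarrow> complex"
  assumes f: "\<And>a. excluded p a \<Longrightarrow> f a = 0" and h: "\<And>b. excluded q b \<Longrightarrow> h b = 0"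
    and N: "p + q = N"
  shows "(\<Sum>a\<in>{0..N}. f a * h (N - a)) = f p * h q"
proof -
  have "(\<Sum>a\<in>{0..N}. f a * h (N - a)) = f p * h (N - p)"
  proof (rule sum_single)
    fix a assume a: "a \<in> {0..N}" "a \<noteq> p"
    then have "excluded p a \<or> excluded q (N - a)" using N by (auto simp: excluded_def)
    then show "f a * h (N - a) = 0" using f h by auto
  qed (use N in auto)
  moreover have "N - p = q" using N by auto
  ultimately show ?thesis by simp
qed

lemma sum_two_pts:
  fixes f :: "nat \<Rightarrow> complex"
  assumes "\<And>b. b \<in> {0..g} \<Longrightarrow> b \<noteq> p \<Longrightarrow> b + 2 \<noteq> p \<Longrightarrow> f b = 0"
  shows "(\<Sum>a\<in>{0..g}. f a) = (if p \<le> g then f p else 0) + (if 2 \<le> p \<and> p - 2 \<le> g then f (p - 2) else 0)"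
proof -
  have "(\<Sum>a\<in>{0..g}. f a) = (\<Sum>a\<in>{0..g}. (if a = p then f a else 0) + (if a = p - 2 \<and> 2 \<le> p then f a else 0))"
  proof (rule sum.cong[OF refl])
    fix a assume a: "a \<in> {0..g}"
    show "f a = (if a = p then f a else 0) + (if a = p - 2 \<and> 2 \<le> p then f a else 0)"
      using assms[OF a] by (cases "a = p"; cases "a = p - 2 \<and> 2 \<le> p") auto
  qed
  also have "\<dots> = (if p \<le> g then f p else 0) + (if 2 \<le> p \<and> p - 2 \<le> g then f (p - 2) else 0)"
    by (cases "2 \<le> p") (simp_all add: sum.distrib sum.delta')
  finally show ?thesis .
qed

lemma convolution_sub:
  fixes f h :: "nat \<Rightarrow> complex"
  assumes f: "\<And>a. excluded p a \<Longrightarrow> f a = 0" and h: "\<And>b. excluded q b \<Longrightarrow> h b = 0"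
    and N: "p + q = N + 2"
  shows "(\<Sum>a\<in>{0..N}. f a * h (N - a))
       = (if 2 \<le> q then f p * h (q - 2) else 0) + (if 2 \<le> p then f (p - 2) * h q else 0)"
proof -
  have "(\<Sum>a\<in>{0..N}. f a * h (N - a))
      = (if p \<le> N then f p * h (N - p) else 0) + (if 2 \<le> p \<and> p - 2 \<le> N then f (p - 2) * h (N - (p - 2)) else 0)"
  proof (rule sum_two_pts)
    fix b assume b: "b \<in> {0..N}" "b \<noteq> p" "b + 2 \<noteq> p"
    then have "excluded p b \<or> excluded q (N - b)" using N unfolding excluded_def by presburger
    then show "f b * h (N - b) = 0" using f h by auto
  qed
  also have "\<dots> = (if 2 \<le> q then f p * h (q - 2) else 0) + (if 2 \<le> p then f (p - 2) * h q else 0)"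
  proof -
    have "p \<le> N \<longleftrightarrow> 2 \<le> q" "2 \<le> p \<Longrightarrow> p - 2 \<le> N" using N by auto
    moreover have "N - p = q - 2" "2 \<le> p \<Longrightarrow> N - (p - 2) = q" using N by auto
    ultimately show ?thesis by auto
  qed
  finally show ?thesis .
qed

context fixes T :: real and W assumes T: "0 < T" and LF: "loop_family T W"
begin

definition vanishes where "vanishes g n \<longleftrightarrow> (\<forall>j x I. length I = n - 1 \<longrightarrow> x \<in> Ucut T \<longrightarrow> set I \<subseteq> Ucut T
     \<longrightarrow> distinct (x # I) \<longrightarrow> excluded g j \<longrightarrow> W g n j (x # I) = 0)"

lemma vanishes_list: "vanishes g n \<Longrightarrow> 1 \<le> n \<Longrightarrow> length xs = n \<Longrightarrow> set xs \<subseteq> Ucut T \<Longrightarrow> distinct xs \<Longrightarrow> excluded g j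
   \<Longrightarrow> W g n j xs = 0"
  unfolding vanishes_def by (cases xs) auto

(* The induction step, by induction on g and then on n: under the hypotheses below each
   of the four terms of the loop equation vanishes at an excluded coefficient. *)
context
  fixes g n j :: nat and x :: complex and I :: "complex list"
  assumes IHg: "\<And>g' n'. g' < g \<Longrightarrow> 1 \<le> n' \<Longrightarrow> vanishes g' n'"
      and IHn: "\<And>n'. n' < n \<Longrightarrow> 1 \<le> n' \<Longrightarrow> vanishes g n'"
      and n: "1 \<le> n" and len: "length I = n - 1" and x: "x \<in> Ucut T"
      and IU: "set I \<subseteq> Ucut T" and dist: "distinct (x # I)" and Z: "excluded g j"
begin

lemma vanish_deriv_term: "(if 1 \<le> g \<and> 1 \<le> j then deriv (\<lambda>t. W (g - 1) n (j - 1) (t # I)) x else 0) = 0"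
proof (cases "1 \<le> g \<and> 1 \<le> j")
  case True
  have "excluded (g - 1) (j - 1)" using Z True unfolding excluded_def by presburger
  then have "deriv (\<lambda>t. W (g - 1) n (j - 1) (t # I)) x = 0"
    using IHg[of "g - 1" n] True n len IU dist x
    by (intro deriv_zero_near[OF open_minus_finite[OF open_Ucut finite_set]]) (auto simp: vanishes_def)
  then show ?thesis by simp
qed auto

lemma vanish_diag_term: "(if 2 \<le> g then W (g - 2) (n + 1) j (x # x # I) else 0) = 0"
proof (cases "2 \<le> g")
  case True
  have Z2: "excluded (g - 2) j" using Z True unfolding excluded_def by presburger
  have lim: "((\<lambda>z. W (g - 2) (n + 1) j (x # z # I)) \<longlongrightarrow> W (g - 2) (n + 1) j (x # x # I)) (at x)"
    by (rule loop_diag_lim[OF LF]) (use n len x IU dist in auto)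
  have "W (g - 2) (n + 1) j (x # x # I) = 0"
  proof (rule lim_zero_near[OF lim open_minus_finite[OF open_Ucut finite_set]])
    show "x \<in> Ucut T - set I" using x dist by auto
    fix t assume "t \<in> Ucut T - set I" "t \<noteq> x"
    then show "W (g - 2) (n + 1) j (x # t # I) = 0"
      using IHg[of "g - 2" "n + 1"] True Z2 len IU dist x n
      unfolding vanishes_def by (auto simp: Suc_diff_le)
  qed
  then show ?thesis by simp
qed auto

(* A product term splits the genus as p + (g - p) and the points as S and its
   complement; unless it is one of the two omitted terms, both factors are covered by
   the induction hypotheses. *)
lemma vanish_product_factors:
  assumes S: "S \<subseteq> {..<n-1}" and p: "p \<le> g"
    and nontriv: "\<not> ((S = {} \<and> p = 0) \<or> (S = {..<n-1} \<and> p = g))"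
  shows "vanishes p (card S + 1)" "vanishes (g - p) (n - card S)"
proof -
  have cS: "card S \<le> n - 1" using card_mono[OF _ S] by simp
  show "vanishes p (card S + 1)"
  proof (cases "p < g")
    case False
    with p nontriv have "S \<subset> {..<n-1}" using S by auto
    then have "card S < n - 1" by (metis card_lessThan finite_lessThan psubset_card_mono)
    then show ?thesis using False p IHn[of "card S + 1"] by auto
  qed (auto intro: IHg)
  show "vanishes (g - p) (n - card S)"
  proof (cases "0 < p")
    case False
    with nontriv have "S \<noteq> {}" by auto
    then have "card S > 0" using S by (auto simp: card_gt_0_iff intro: finite_subset)
    then show ?thesis using False cS IHn[of "n - card S"] by auto
  qed (use cS n p in \<open>auto intro: IHg\<close>)
qed

lemma vanish_product_term:
  "(\<Sum>S \<in> Pow {..<n-1}. \<Sum>p \<in> {0..g}.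
     if (S = {} \<and> p = 0) \<or> (S = {..<n-1} \<and> p = g) then 0
     else (\<Sum>a \<in> {0..j}. W p (card S + 1) a (x # nths I S)
            * W (g - p) (n - card S) (j - a) (x # nths I ({..<n-1} - S)))) = 0"
proof (intro sum.neutral ballI)
  fix S p assume S: "S \<in> Pow {..<n-1}" and p: "p \<in> {0..g}"
  show "(if (S = {} \<and> p = 0) \<or> (S = {..<n-1} \<and> p = g) then 0
     else (\<Sum>a \<in> {0..j}. W p (card S + 1) a (x # nths I S)
            * W (g - p) (n - card S) (j - a) (x # nths I ({..<n-1} - S)))) = 0"
  proof (cases "(S = {} \<and> p = 0) \<or> (S = {..<n-1} \<and> p = g)")
    case False
    note V = vanish_product_factors[of S p] 
    have cC: "card ({..<n-1} - S) = n - card S - 1"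
      using S by (subst card_Diff_subset) (auto intro: finite_subset)
    note P1 = nths_points[of S I "Ucut T" x] and P2 = nths_points[of "{..<n-1} - S" I "Ucut T" x]
    have prod0: "W p (card S + 1) a (x # nths I S) * W (g - p) (n - card S) (j - a) (x # nths I ({..<n-1} - S)) = 0"
      if a: "a \<in> {0..j}" for a
    proof -
      have "excluded p a \<or> excluded (g - p) (j - a)" by (rule excluded_split[OF Z]) (use a p in auto)
      then show ?thesis
        using V False S p P1 P2 cC len IU dist x unfolding vanishes_def by auto
    qed
    have "(\<Sum>a \<in> {0..j}. W p (card S + 1) a (x # nths I S)
            * W (g - p) (n - card S) (j - a) (x # nths I ({..<n-1} - S))) = 0"
      using prod0 by (intro sum.neutral) blast
    then show ?thesis using False by simp
  qed simp
qed

(* The residue term: each summand is the derivative of a function vanishing near I ! i. *)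
lemma vanish_residue_term:
  "(\<Sum>i < n - 1. deriv (\<lambda>t. (W g (n - 1) j (x # nths I ({..<n-1} - {i}))
                                   - W g (n - 1) j (I[i := t])) / (x - t)) (I ! i)) = 0"
proof (intro sum.neutral ballI)
  fix i assume i: "i \<in> {..<n - 1}"
  have n2: "1 \<le> n - 1" using i by auto
  have V: "vanishes g (n - 1)" by (rule IHn) (use i in auto)
  define U where "U = Ucut T - (set I - {I ! i})"
  have U: "open U" unfolding U_def by (rule open_minus_finite[OF open_Ucut]) simp
  have iU: "I ! i \<in> U" using i len IU by (auto simp: U_def)
  note P = nths_points[of "{..<n-1} - {i}" I "Ucut T" x]
  have W1: "W g (n - 1) j (x # nths I ({..<n-1} - {i})) = 0"
    using V P i len IU dist x Z unfolding vanishes_def by auto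
  have W2: "W g (n - 1) j (I[i := t]) = 0" if t: "t \<in> U" for t
  proof (rule vanishes_list[OF V n2])
    show "length (I[i := t]) = n - 1" using len by simp
    show "set (I[i := t]) \<subseteq> Ucut T" using IU t set_update_subset_insert[of I i t] by (auto simp: U_def)
    show "distinct (I[i := t])" using dist t by (intro distinct_list_update) (auto simp: U_def)
  qed (rule Z)
  show "deriv (\<lambda>t. (W g (n - 1) j (x # nths I ({..<n-1} - {i})) - W g (n - 1) j (I[i := t])) / (x - t)) (I ! i) = 0"
  proof (rule deriv_zero_near[OF U iU])
    fix t assume "t \<in> U"
    then show "(W g (n - 1) j (x # nths I ({..<n-1} - {i})) - W g (n - 1) j (I[i := t])) / (x - t) = 0"
      using W1 W2[of t] by simp
  qed
qed

lemma vanish_step_point: "W g n j (x # I) = 0"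
proof (cases "(n, g) = (1, 0)")
  case True
  then have "1 \<le> j" using Z by (auto simp: excluded_def Suc_le_eq odd_pos)
  with True show ?thesis using loop_base_vanish[OF LF x] len by auto
next
  case False
  have "ybr T x * W g n j (x # I) = loop_rhs T W g n j x I"
    by (rule loop_eq[OF LF n False x len IU dist])
  also have "\<dots> = 0" unfolding loop_rhs_def
    using vanish_deriv_term vanish_diag_term vanish_product_term vanish_residue_term by simp
  finally show ?thesis using ybr_nonzero[OF T x] by simp
qed

end

lemma vanishes_all: "1 \<le> n \<Longrightarrow> vanishes g n"
proof (induction g arbitrary: n rule: less_induct)
  case (less g)
  show ?case using less.prems
  proof (induction n rule: less_induct)
    case (less n)
    show ?case unfolding vanishes_def
      by (intro allI impI vanish_step_point) (use less.IH less.prems \<open>\<And>y n. y < g \<Longrightarrow> 1 \<le> n \<Longrightarrow> vanishes y n\<close> in auto)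
  qed
qed

(* Excluded coefficients vanish at distinct points, and on the diagonal by regularity. *)
lemma vanish: "1 \<le> n \<Longrightarrow> length xs = n \<Longrightarrow> set xs \<subseteq> Ucut T \<Longrightarrow> distinct xs \<Longrightarrow> excluded g j
   \<Longrightarrow> W g n j xs = 0"
  by (rule vanishes_list[OF vanishes_all])

lemma vanish_diag: "2 \<le> m \<Longrightarrow> x \<in> Ucut T \<Longrightarrow> length I = m - 2 \<Longrightarrow> set I \<subseteq> Ucut T
        \<Longrightarrow> distinct (x # I) \<Longrightarrow> excluded g j \<Longrightarrow> W g m j (x # x # I) = 0"
proof -
  assume m: "2 \<le> m" and x: "x \<in> Ucut T" and len: "length I = m - 2" and IU: "set I \<subseteq> Ucut T"
    and dist: "distinct (x # I)" and Z: "excluded g j"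
  have U0: "open (Ucut T - set I)" by (rule open_minus_finite[OF open_Ucut]) simp
  show ?thesis
  proof (rule lim_zero_near[OF loop_diag_lim[OF LF m x len IU dist] U0])
    show "x \<in> Ucut T - set I" using x dist by auto
    fix t assume "t \<in> Ucut T - set I" "t \<noteq> x"
    then show "W g m j (x # t # I) = 0"
      using m len IU dist x Z by (intro vanish) auto
  qed
qed

end

section \<open>The top coefficient t_g = [hbar^g] W_1^(g)\<close>

(* With n = 1 and j = g the loop equation reads y t_g = t_(g-1)' + sum_(0<p<g) t_p t_(g-p),
   since the diagonal term W_2^(g-2) has no hbar^g part; t_0 = (x - y)/2. *)
fun t_yf :: "real \<Rightarrow> nat \<Rightarrow> yfrac" where
  "t_yf T 0 = ([:0, 1/2:], [:-1/2:], 0)"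
| "t_yf T (Suc g) = yf_divy (yf_sum T (3*g+1) (yf_deriv T (t_yf T g) # map (\<lambda>p. yf_mult T (t_yf T p) (t_yf T (Suc g - p))) [1..<Suc g]))"

declare t_yf.simps[simp del]

abbreviation t_summands :: "real \<Rightarrow> nat \<Rightarrow> yfrac list" where
  "t_summands T h \<equiv> yf_deriv T (t_yf T h) # map (\<lambda>p. yf_mult T (t_yf T p) (t_yf T (Suc h - p))) [1..<Suc h]"

lemma t_yf_Suc: "t_yf T (Suc h) = yf_divy (yf_sum T (3*h+1) (t_summands T h))"
  by (simp add: t_yf.simps)

lemma t_summands_props:
  assumes IH: "\<And>p. p \<le> h \<Longrightarrow> yexp (t_yf T p) = (if p = 0 then 0 else 3*p - 1) \<and> tame (2 * int p - 1) (t_yf T p)"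
    and X: "X \<in> set (t_summands T h)"
  shows "tame (2 * int h) X \<and> yexp X \<le> 3*h+1"
proof -
  consider "X = yf_deriv T (t_yf T h)" | p where "p \<in> {1..<Suc h}" "X = yf_mult T (t_yf T p) (t_yf T (Suc h - p))"
    using X by (auto simp del: upt_Suc)
  then show ?thesis
  proof cases
    case 1
    have "tame (2 * int h - 1 + 1) X" unfolding 1 using IH[of h] by (intro tame_deriv) auto
    then show ?thesis using IH[of h] 1 by (auto simp: yexp_deriv)
  next
    case (2 p)
    have i: "tame (2 * int p - 1) (t_yf T p)" "shaped (2 * int (Suc h - p) - 1) (t_yf T (Suc h - p))"
      using IH[of p] IH[of "Suc h - p"] 2 by (auto simp: tame_def)
    have "tame (2 * int p - 1 + (2 * int (Suc h - p) - 1)) X" unfolding 2 by (rule tame_mult_left[OF i])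
    moreover have "2 * int p - 1 + (2 * int (Suc h - p) - 1) = 2 * int h" using 2 by auto
    ultimately show ?thesis using IH[of p] IH[of "Suc h - p"] 2 by auto
  qed
qed

lemma t_yf_props: "yexp (t_yf T g) = (if g = 0 then 0 else 3*g - 1) \<and> tame (2 * int g - 1) (t_yf T g)"
proof (induction g rule: less_induct)
  case (less g)
  show ?case
  proof (cases g)
    case 0
    have "parity [:0, 1/2:] 1" "parity [:-1/2:] 2" unfolding parity_def by (auto simp: coeff_pCons split: nat.splits)
    moreover have "deg_le [:0, 1/2:] 1" "deg_le [:-1/2:] 0" by (auto simp: deg_le_def)
    ultimately show ?thesis using 0 by (simp add: t_yf.simps tame_def)
  next
    case (Suc h)
    have IH: "\<And>p. p \<le> h \<Longrightarrow> yexp (t_yf T p) = (if p = 0 then 0 else 3*p - 1) \<and> tame (2 * int p - 1) (t_yf T p)"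
      using less.IH Suc by auto
    have "tame (2 * int h) (yf_sum T (3*h+1) (t_summands T h)) \<and> yexp (yf_sum T (3*h+1) (t_summands T h)) = 3*h+1"
      by (rule tame_sum[OF t_summands_props[OF IH]]) simp_all
    then show ?thesis using tame_divy[of "2 * int h" "yf_sum T (3*h+1) (t_summands T h)"] Suc
      by (simp add: t_yf_Suc algebra_simps)
  qed
qed

lemma yexp_t_yf: "yexp (t_yf T p) = (if p = 0 then 0 else 3*p - 1)" using t_yf_props by blast
lemma tame_t_yf: "tame (2 * int p - 1) (t_yf T p)" using t_yf_props by blast
lemma shaped_t_yf: "shaped (2 * int p - 1) (t_yf T p)" using tame_t_yf by (simp add: tame_def)

lemma sum_drop_ends:
  fixes f :: "nat \<Rightarrow> complex"
  shows "(\<Sum>p\<in>{0..N}. if p = 0 \<or> p = N then 0 else f p) = (\<Sum>p\<in>{1..<N}. f p)"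
  by (rule sum.mono_neutral_cong_right) auto

context fixes T :: real and W assumes T: "0 < T" and LF: "loop_family T W"
begin

lemma W1_excluded: "excluded g j \<Longrightarrow> x \<in> Ucut T \<Longrightarrow> W g 1 j [x] = 0"
  by (rule vanish[OF T LF]) auto

lemma loop_rhs_1: "x \<in> Ucut T \<Longrightarrow> loop_rhs T W g 1 j x [] =
     (if 1 \<le> g \<and> 1 \<le> j then deriv (\<lambda>t. W (g - 1) 1 (j - 1) [t]) x else 0)
   + (if 2 \<le> g then W (g - 2) 2 j [x, x] else 0)
   + (\<Sum>p\<in>{0..g}. if p = 0 \<or> p = g then 0 else (\<Sum>a\<in>{0..j}. W p 1 a [x] * W (g - p) 1 (j - a) [x]))"
proof -
  have e: "Pow {..<(1::nat) - 1} = {{}}" by simp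
  show ?thesis unfolding loop_rhs_def e by (simp add: numeral_2_eq_2 cong: if_cong)
qed

lemma W1_top_loop:
  assumes x: "x \<in> Ucut T"
    and IH: "\<And>p t. p \<le> h \<Longrightarrow> t \<in> Ucut T \<Longrightarrow> W p 1 p [t] = yf_eval T (t_yf T p) t"
  shows "ybr T x * W (Suc h) 1 (Suc h) [x]
       = yf_eval T (yf_deriv T (t_yf T h)) x + (\<Sum>p\<in>{1..<Suc h}. yf_eval T (t_yf T p) x * yf_eval T (t_yf T (Suc h - p)) x)"
proof -
  let ?g = "Suc h"
  have d: "deriv (\<lambda>t. W h 1 h [t]) x = yf_eval T (yf_deriv T (t_yf T h)) x"
    by (rule deriv_eq_yf_eval[OF T x]) (rule IH, auto)
  have diag: "2 \<le> ?g \<Longrightarrow> W (?g - 2) 2 ?g [x, x] = 0"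
    by (rule vanish_diag[OF T LF, of 2 x "[]"]) (use x in \<open>auto simp: excluded_def\<close>)
  have prod: "(\<Sum>a\<in>{0..?g}. W p 1 a [x] * W (?g - p) 1 (?g - a) [x])
      = yf_eval T (t_yf T p) x * yf_eval T (t_yf T (?g - p)) x" if p: "p \<in> {1..<?g}" for p
  proof -
    have "(\<Sum>a\<in>{0..?g}. W p 1 a [x] * W (?g - p) 1 (?g - a) [x]) = W p 1 p [x] * W (?g - p) 1 (?g - p) [x]"
      by (rule convolution_top) (use W1_excluded x p in auto)
    also have "\<dots> = yf_eval T (t_yf T p) x * yf_eval T (t_yf T (?g - p)) x"
    proof -
      have "p \<le> h" "?g - p \<le> h" using p by auto
      then show ?thesis using IH[of p x] IH[of "?g - p" x] x by simp
    qed
    finally show ?thesis .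
  qed
  have "ybr T x * W ?g 1 ?g [x] = loop_rhs T W ?g 1 ?g x []"
    by (rule loop_eq[OF LF]) (use x in auto)
  also have "\<dots> = yf_eval T (yf_deriv T (t_yf T h)) x + (\<Sum>p\<in>{1..<?g}. yf_eval T (t_yf T p) x * yf_eval T (t_yf T (?g - p)) x)"
    unfolding loop_rhs_1[OF x] sum_drop_ends using d diag prod by simp
  finally show ?thesis .
qed

lemma W1_top_eq: "x \<in> Ucut T \<Longrightarrow> W g 1 g [x] = yf_eval T (t_yf T g) x"
proof (induction g arbitrary: x rule: less_induct)
  case (less g)
  note x = less.prems
  show ?case
  proof (cases g)
    case 0
    then show ?thesis using loop_base[OF LF x] by (simp add: field_simps t_yf.simps)
  next
    case (Suc h)
    have IH: "\<And>p t. p \<le> h \<Longrightarrow> t \<in> Ucut T \<Longrightarrow> W p 1 p [t] = yf_eval T (t_yf T p) t"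
      using less.IH Suc by auto
    have bound: "\<And>X. X \<in> set (t_summands T h) \<Longrightarrow> yexp X \<le> 3*h+1"
      using t_summands_props t_yf_props by blast
    have "ybr T x * W g 1 g [x] = yf_eval T (yf_deriv T (t_yf T h)) x
        + (\<Sum>p\<in>{1..<Suc h}. yf_eval T (t_yf T p) x * yf_eval T (t_yf T (Suc h - p)) x)"
      using W1_top_loop[OF x IH] Suc by simp
    also have "\<dots> = (\<Sum>X\<leftarrow>t_summands T h. yf_eval T X x)"
      by (simp add: yf_eval_mult[OF T x] sum_set_upt_conv_sum_list_nat[symmetric] comp_def)
    also have "\<dots> = yf_eval T (yf_sum T (3*h+1) (t_summands T h)) x"
      by (rule yf_eval_sum[OF T x bound, symmetric])
    finally show ?thesis using ybr_nonzero[OF T x] by (simp add: Suc t_yf_Suc yf_eval_divy[OF T x] field_simps)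
  qed
qed

end

section \<open>The top two-point coefficient u_h = [hbar^h] W_2^(h)\<close>

declare tquot.simps[simp del] yf_eval.simps[simp del]

(* A term (a, F, k) stands for a(x) * tquot F k (x, z); u_h(x,z) is a finite sum of such
   terms, in the list u_terms T h. *)
type_synonym tterm = "yfrac \<times> yfrac \<times> nat"

definition terms_eval :: "real \<Rightarrow> tterm list \<Rightarrow> complex \<Rightarrow> complex \<Rightarrow> complex" where
  "terms_eval T L x z = (\<Sum>(a,F,k)\<leftarrow>L. yf_eval T a x * tquot T F k x z)"

(* The value on the diagonal z = x, by tquot_lim. *)
definition terms_diag :: "real \<Rightarrow> tterm list \<Rightarrow> complex \<Rightarrow> complex" where
  "terms_diag T L x = (\<Sum>(a,F,k)\<leftarrow>L. yf_eval T a x * (yf_eval T (yf_derivs T k F) x / fact k))"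

(* d/dx of a list of terms, by the product rule and tquot_deriv. *)
definition terms_deriv :: "real \<Rightarrow> tterm list \<Rightarrow> tterm list" where
  "terms_deriv T L = concat (map (\<lambda>(a,F,k). [(yf_deriv T a, F, k), (a, yf_deriv T F, k), (yf_smult (- of_nat k) a, F, Suc k)]) L)"

definition terms_mult :: "real \<Rightarrow> yfrac \<Rightarrow> tterm list \<Rightarrow> tterm list" where
  "terms_mult T b L = map (\<lambda>(a,F,k). (yf_mult T b a, F, k)) L"

definition terms_divy :: "tterm list \<Rightarrow> tterm list" where
  "terms_divy L = map (\<lambda>(a,F,k). (yf_divy a, F, k)) L"

definition yf_one :: yfrac where "yf_one = ([:1:], 0, 0)"
definition yf_inv_y :: yfrac where "yf_inv_y = ([:1:], 0, 1)"

(* The loop equation with n = 2 and j = h gives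
     y u_h = d/dx u_(h-1) + sum_(p=1..h) t_p u_(h-p) + sum_(p=0..h-1) t_(h-p) u_p + tquot t_h 2,
   the last term coming from the residue term (t_h(x) - t_h(z))/(x - z) differentiated in z. *)
fun u_terms :: "real \<Rightarrow> nat \<Rightarrow> tterm list" where
  "u_terms T 0 = [(yf_inv_y, t_yf T 0, 2)]"
| "u_terms T (Suc h) = terms_divy (terms_deriv T (u_terms T h)
      @ concat (map (\<lambda>p. terms_mult T (t_yf T p) (u_terms T (Suc h - p))) [1..<Suc (Suc h)])
      @ concat (map (\<lambda>p. terms_mult T (t_yf T (Suc h - p)) (u_terms T p)) [0..<Suc h])
      @ [(yf_one, t_yf T (Suc h), 2)])"

declare u_terms.simps[simp del]

fun term_diag_yf :: "real \<Rightarrow> tterm \<Rightarrow> yfrac" where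
  "term_diag_yf T (a,F,k) = yf_smult (1 / fact k) (yf_mult T a (yf_derivs T k F))"

definition diag_yf :: "real \<Rightarrow> nat \<Rightarrow> yfrac" where
  "diag_yf T h = yf_sum T (3*h+4) (map (term_diag_yf T) (u_terms T h))"

lemma terms_eval_nil[simp]: "terms_eval T [] x z = 0" by (simp add: terms_eval_def)
lemma terms_eval_cons[simp]: "terms_eval T ((a,F,k) # L) x z = yf_eval T a x * tquot T F k x z + terms_eval T L x z"
  by (simp add: terms_eval_def)
lemma terms_eval_append[simp]: "terms_eval T (L1 @ L2) x z = terms_eval T L1 x z + terms_eval T L2 x z"
  by (simp add: terms_eval_def)
lemma terms_eval_concat: "terms_eval T (concat (map f xs)) x z = (\<Sum>p\<leftarrow>xs. terms_eval T (f p) x z)"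
  by (induction xs) auto

lemma terms_diag_nil[simp]: "terms_diag T [] x = 0" by (simp add: terms_diag_def)
lemma terms_diag_cons[simp]: "terms_diag T ((a,F,k) # L) x = yf_eval T a x * (yf_eval T (yf_derivs T k F) x / fact k) + terms_diag T L x"
  by (simp add: terms_diag_def)

context fixes T :: real and x :: complex assumes T: "0 < T" and x: "x \<in> Ucut T"
begin

lemma terms_eval_mult: "terms_eval T (terms_mult T b L) x z = yf_eval T b x * terms_eval T L x z"
proof (induction L)
  case Nil then show ?case by (simp add: terms_mult_def)
next
  case (Cons tterm L)
  obtain a F k where tterm: "tterm = (a,F,k)" by (cases tterm) auto
  have "terms_mult T b (tterm # L) = (yf_mult T b a, F, k) # terms_mult T b L" by (simp add: terms_mult_def tterm)
  then show ?case using Cons.IH by (simp add: tterm yf_eval_mult[OF T x] algebra_simps)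
qed

lemma terms_eval_divy: "terms_eval T (terms_divy L) x z = terms_eval T L x z / ybr T x"
proof (induction L)
  case Nil then show ?case by (simp add: terms_divy_def)
next
  case (Cons tterm L)
  obtain a F k where tterm: "tterm = (a,F,k)" by (cases tterm) auto
  have "terms_divy (tterm # L) = (yf_divy a, F, k) # terms_divy L" by (simp add: terms_divy_def tterm)
  then show ?case using Cons.IH by (simp add: tterm yf_eval_divy[OF T x] add_divide_distrib)
qed

lemma terms_eval_deriv: "x \<noteq> z \<Longrightarrow> ((\<lambda>t. terms_eval T L t z) has_field_derivative terms_eval T (terms_deriv T L) x z) (at x)"
proof (induction L)
  case Nil then show ?case by (simp add: terms_deriv_def)
next
  case (Cons tterm L)
  obtain a F k where tterm: "tterm = (a,F,k)" by (cases tterm) auto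
  have d1: "((\<lambda>t. yf_eval T a t * tquot T F k t z) has_field_derivative
      yf_eval T (yf_deriv T a) x * tquot T F k x z + yf_eval T a x * (tquot T (yf_deriv T F) k x z - of_nat k * tquot T F (Suc k) x z)) (at x)"
    using DERIV_mult[OF yf_eval_deriv[OF T x] tquot_deriv[OF T x Cons.prems]] by (simp add: algebra_simps)
  have "((\<lambda>t. yf_eval T a t * tquot T F k t z + terms_eval T L t z) has_field_derivative
      (yf_eval T (yf_deriv T a) x * tquot T F k x z + yf_eval T a x * (tquot T (yf_deriv T F) k x z - of_nat k * tquot T F (Suc k) x z))
       + terms_eval T (terms_deriv T L) x z) (at x)"
    by (rule DERIV_add[OF d1 Cons.IH[OF Cons.prems]])
  moreover have "terms_deriv T (tterm # L) = [(yf_deriv T a, F, k), (a, yf_deriv T F, k), (yf_smult (- of_nat k) a, F, Suc k)] @ terms_deriv T L"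
    by (simp add: terms_deriv_def tterm)
  ultimately show ?case by (simp add: tterm yf_eval_smult[OF T x] algebra_simps)
qed


end

(* term_inv T W M (a,F,k): the diagonal value a F^(k)/k! of the term is a product of a
   fraction of some weight and a tame fraction, of total weight W and exponent at most M;
   hence it is tame of weight W. *)
fun term_inv :: "real \<Rightarrow> int \<Rightarrow> nat \<Rightarrow> tterm \<Rightarrow> bool" where
  "term_inv T Wt Mb (a,F,k) \<longleftrightarrow> (\<exists>wa wf. shaped wa a \<and> tame wf F
       \<and> wa + wf + int k = Wt \<and> yexp a + yexp (yf_derivs T k F) \<le> Mb)"

definition terms_inv :: "real \<Rightarrow> int \<Rightarrow> nat \<Rightarrow> tterm list \<Rightarrow> bool" where
  "terms_inv T Wt Mb L \<longleftrightarrow> (\<forall>t\<in>set L. term_inv T Wt Mb t)"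

lemma terms_inv_append: "terms_inv T W M L1 \<Longrightarrow> terms_inv T W M L2 \<Longrightarrow> terms_inv T W M (L1 @ L2)"
  unfolding terms_inv_def by auto
lemma terms_inv_concat: "(\<And>p. p \<in> set xs \<Longrightarrow> terms_inv T W M (f p)) \<Longrightarrow> terms_inv T W M (concat (map f xs))"
  unfolding terms_inv_def by auto

lemma terms_inv_divy: assumes "terms_inv T W M L" shows "terms_inv T (W + 1) (M + 1) (terms_divy L)"
  unfolding terms_inv_def terms_divy_def
proof
  fix t assume "t \<in> set (map (\<lambda>(a,F,k). (yf_divy a, F, k)) L)"
  then obtain a F k where m: "(a,F,k) \<in> set L" and t: "t = (yf_divy a, F, k)" by auto
  then obtain wa wf where h: "shaped wa a" "tame wf F" "wa + wf + int k = W" "yexp a + yexp (yf_derivs T k F) \<le> M"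
    using assms unfolding terms_inv_def by fastforce
  show "term_inv T (W + 1) (M + 1) t" unfolding t term_inv.simps
    using shaped_divy[OF h(1)] h by (intro exI[of _ "wa + 1"] exI[of _ wf]) auto
qed

lemma terms_inv_mult: assumes "shaped wb b" "terms_inv T W M L" shows "terms_inv T (W + wb) (M + yexp b) (terms_mult T b L)"
  unfolding terms_inv_def terms_mult_def
proof
  fix t assume "t \<in> set (map (\<lambda>(a,F,k). (yf_mult T b a, F, k)) L)"
  then obtain a F k where m: "(a,F,k) \<in> set L" and t: "t = (yf_mult T b a, F, k)" by auto
  then obtain wa wf where h: "shaped wa a" "tame wf F" "wa + wf + int k = W" "yexp a + yexp (yf_derivs T k F) \<le> M"
    using assms(2) unfolding terms_inv_def by fastforce
  show "term_inv T (W + wb) (M + yexp b) t" unfolding t term_inv.simps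
    using shaped_mult[OF assms(1) h(1), of T] h by (intro exI[of _ "wb + wa"] exI[of _ wf]) auto
qed

lemma terms_inv_deriv: assumes "terms_inv T W M L" shows "terms_inv T (W + 1) (M + 2) (terms_deriv T L)"
  unfolding terms_inv_def terms_deriv_def
proof
  fix t assume "t \<in> set (concat (map (\<lambda>(a,F,k). [(yf_deriv T a, F, k), (a, yf_deriv T F, k), (yf_smult (- of_nat k) a, F, Suc k)]) L))"
  then obtain a F k where m: "(a,F,k) \<in> set L" and
    t: "t = (yf_deriv T a, F, k) \<or> t = (a, yf_deriv T F, k) \<or> t = (yf_smult (- of_nat k) a, F, Suc k)" by auto
  then obtain wa wf where h: "shaped wa a" "tame wf F" "wa + wf + int k = W" "yexp a + yexp (yf_derivs T k F) \<le> M"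
    using assms unfolding terms_inv_def by fastforce
  have k1: "yexp (yf_derivs T (Suc k) F) \<le> yexp (yf_derivs T k F) + 2" using yexp_deriv_le[of T "yf_derivs T k F"] by simp
  have t1: "term_inv T (W + 1) (M + 2) (yf_deriv T a, F, k)" unfolding term_inv.simps
    using shaped_deriv[OF h(1), of T] h yexp_deriv_le[of T a] by (intro exI[of _ "wa + 1"] exI[of _ wf]) auto
  have t2: "term_inv T (W + 1) (M + 2) (a, yf_deriv T F, k)" unfolding term_inv.simps yf_derivs_deriv
    using tame_deriv[OF h(2), of T] h k1 by (intro exI[of _ wa] exI[of _ "wf + 1"]) auto
  have t3: "term_inv T (W + 1) (M + 2) (yf_smult (- of_nat k) a, F, Suc k)" unfolding term_inv.simps
    using shaped_smult[OF h(1)] h k1 by (intro exI[of _ wa] exI[of _ wf]) auto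
  show "term_inv T (W + 1) (M + 2) t" using t t1 t2 t3 by (auto simp del: term_inv.simps)
qed

lemma terms_inv_mult_t:
  assumes "terms_inv T (2 * int p + 2) (3*p+4) L" and q: "1 \<le> q"
  shows "terms_inv T (2 * int (p + q) + 1) (3*(p + q)+3) (terms_mult T (t_yf T q) L)"
proof -
  have "terms_inv T (2 * int p + 2 + (2 * int q - 1)) (3*p+4 + yexp (t_yf T q)) (terms_mult T (t_yf T q) L)"
    by (rule terms_inv_mult[OF shaped_t_yf assms(1)])
  moreover have "2 * int p + 2 + (2 * int q - 1) = 2 * int (p + q) + 1" "3*p+4 + yexp (t_yf T q) = 3*(p + q)+3"
    using q by (auto simp: yexp_t_yf)
  ultimately show ?thesis by simp
qed

lemma u_terms_inv: "terms_inv T (2 * int h + 2) (3*h+4) (u_terms T h)"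
proof (induction h rule: less_induct)
  case (less h)
  show ?case
  proof (cases h)
    case 0
    have "shaped 1 yf_inv_y" by (simp add: yf_inv_y_def deg_le_def parity_const)
    moreover have "yexp (yf_derivs T 2 (t_yf T 0)) = 3" by (simp add: numeral_2_eq_2 t_yf.simps)
    ultimately have "term_inv T 2 4 (yf_inv_y, t_yf T 0, 2)" unfolding term_inv.simps
      using tame_t_yf[of 0 T] by (intro exI[of _ 1] exI[of _ "-1"]) (simp add: yf_inv_y_def)
    then show ?thesis using 0 by (simp add: terms_inv_def u_terms.simps)
  next
    case (Suc g)
    have IH: "\<And>p. p \<le> g \<Longrightarrow> terms_inv T (2 * int p + 2) (3*p+4) (u_terms T p)" using less.IH Suc by auto
    have A: "terms_inv T (2 * int g + 3) (3*g+6) (terms_deriv T (u_terms T g))"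
      using terms_inv_deriv[OF IH[of g]] by (simp add: algebra_simps)
    have B: "terms_inv T (2 * int g + 3) (3*g+6) (concat (map (\<lambda>p. terms_mult T (t_yf T p) (u_terms T (Suc g - p))) [1..<Suc (Suc g)]))"
    proof (rule terms_inv_concat)
      fix p assume "p \<in> set [1..<Suc (Suc g)]"
      then have p: "1 \<le> p" "p \<le> Suc g" by auto
      have "Suc g - p \<le> g" using p by auto
      from terms_inv_mult_t[OF IH[OF this] p(1)] p
      show "terms_inv T (2 * int g + 3) (3*g+6) (terms_mult T (t_yf T p) (u_terms T (Suc g - p)))"
        by (simp add: ac_simps)
    qed
    have C: "terms_inv T (2 * int g + 3) (3*g+6) (concat (map (\<lambda>p. terms_mult T (t_yf T (Suc g - p)) (u_terms T p)) [0..<Suc g]))"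
    proof (rule terms_inv_concat)
      fix p assume "p \<in> set [0..<Suc g]"
      then have p: "p \<le> g" by auto
      from terms_inv_mult_t[OF IH[OF p], of "Suc g - p"] p
      show "terms_inv T (2 * int g + 3) (3*g+6) (terms_mult T (t_yf T (Suc g - p)) (u_terms T p))"
        by (simp add: ac_simps)
    qed
    have D: "terms_inv T (2 * int g + 3) (3*g+6) [(yf_one, t_yf T (Suc g), 2)]"
    proof -
      have "shaped 0 yf_one" by (simp add: yf_one_def deg_le_def parity_const)
      moreover have "yexp (yf_derivs T 2 (t_yf T (Suc g))) \<le> 3*g+6"
        using yexp_derivs[where T=T and k=2 and F="t_yf T (Suc g)"] by (simp add: yexp_t_yf)
      ultimately have "term_inv T (2 * int g + 3) (3*g+6) (yf_one, t_yf T (Suc g), 2)" unfolding term_inv.simps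
        using tame_t_yf[of "Suc g" T] by (intro exI[of _ 0] exI[of _ "2 * int (Suc g) - 1"]) (simp add: yf_one_def)
      then show ?thesis by (simp add: terms_inv_def)
    qed
    have "terms_inv T (2 * int g + 3 + 1) (3*g+6+1) (u_terms T (Suc g))"
      unfolding u_terms.simps by (intro terms_inv_divy terms_inv_append A B C D)
    then show ?thesis using Suc by (simp add: algebra_simps)
  qed
qed

lemma term_diag_yf_props:
  assumes "term_inv T W M t" shows "tame W (term_diag_yf T t) \<and> yexp (term_diag_yf T t) \<le> M"
proof -
  obtain a F k where t: "t = (a,F,k)" by (cases t) auto
  obtain wa wf where h: "shaped wa a" "tame wf F" "wa + wf + int k = W" "yexp a + yexp (yf_derivs T k F) \<le> M"
    using assms unfolding t by auto
  have "tame (wa + (wf + int k)) (yf_mult T a (yf_derivs T k F))"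
    by (rule tame_mult_right[OF h(1) tame_derivs[OF h(2)]])
  then show ?thesis using h(3,4) unfolding t by (simp add: tame_smult algebra_simps)
qed

lemma diag_yf_props: "tame (2 * int h + 2) (diag_yf T h) \<and> yexp (diag_yf T h) = 3*h+4"
  unfolding diag_yf_def
  by (rule tame_sum) (use u_terms_inv[of T h] term_diag_yf_props in \<open>auto simp: terms_inv_def\<close>)

lemma yf_eval_diag_yf:
  assumes T: "0 < T" and x: "x \<in> Ucut T"
  shows "yf_eval T (diag_yf T h) x = terms_diag T (u_terms T h) x"
proof -
  have "yf_eval T (diag_yf T h) x = (\<Sum>X\<leftarrow>map (term_diag_yf T) (u_terms T h). yf_eval T X x)"
    unfolding diag_yf_def
    by (rule yf_eval_sum[OF T x]) (use u_terms_inv[of T h] term_diag_yf_props in \<open>auto simp: terms_inv_def\<close>)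
  also have "\<dots> = terms_diag T (u_terms T h) x"
    unfolding terms_diag_def map_map
    by (intro arg_cong[where f=sum_list] map_cong refl)
       (auto simp: yf_eval_smult[OF T x] yf_eval_mult[OF T x])
  finally show ?thesis .
qed

lemma sum_drop_first:
  fixes f :: "nat \<Rightarrow> complex"
  shows "(\<Sum>p\<in>{0..N}. if p = 0 then 0 else f p) = (\<Sum>p\<in>{1..<Suc N}. f p)"
  by (rule sum.mono_neutral_cong_right) auto

lemma sum_drop_last:
  fixes f :: "nat \<Rightarrow> complex"
  shows "(\<Sum>p\<in>{0..N}. if p = N then 0 else f p) = (\<Sum>p\<in>{0..<N}. f p)"
  by (rule sum.mono_neutral_cong_right) auto

(* For n = 2 the subsets of the one further point z are {} and {z}. *)
lemma loop_rhs_2: "loop_rhs T W g 2 j x [z] =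
     (if 1 \<le> g \<and> 1 \<le> j then deriv (\<lambda>t. W (g - 1) 2 (j - 1) [t, z]) x else 0)
   + (if 2 \<le> g then W (g - 2) 3 j [x, x, z] else 0)
   + (\<Sum>p\<in>{0..g}. if p = 0 then 0 else (\<Sum>a\<in>{0..j}. W p 1 a [x] * W (g - p) 2 (j - a) [x, z]))
   + (\<Sum>p\<in>{0..g}. if p = g then 0 else (\<Sum>a\<in>{0..j}. W p 2 a [x, z] * W (g - p) 1 (j - a) [x]))
   + deriv (\<lambda>t. (W g 1 j [x] - W g 1 j [t]) / (x - t)) z"
proof -
  have e1: "{..<(2::nat) - 1} = {0}" by auto
  have e2: "Pow {0::nat} = {{}, {0}}" by auto
  have e3: "(2::nat) + 1 = 3" by simp
  show ?thesis unfolding loop_rhs_def e1 e2 e3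
    by (simp add: numeral_2_eq_2 sum.insert cong: if_cong)
qed

context fixes T :: real and W assumes T: "0 < T" and LF: "loop_family T W"
begin

lemma W2_excluded: "excluded g j \<Longrightarrow> x \<in> Ucut T \<Longrightarrow> z \<in> Ucut T \<Longrightarrow> x \<noteq> z \<Longrightarrow> W g 2 j [x, z] = 0"
  by (rule vanish[OF T LF]) auto

lemma W2_top_loop:
  assumes x: "x \<in> Ucut T" and z: "z \<in> Ucut T" and xz: "x \<noteq> z"
    and IH: "\<And>p x z. p < h \<Longrightarrow> x \<in> Ucut T \<Longrightarrow> z \<in> Ucut T \<Longrightarrow> x \<noteq> z \<Longrightarrow> W p 2 p [x, z] = terms_eval T (u_terms T p) x z"
  shows "ybr T x * W h 2 h [x, z]
     = (if 1 \<le> h then deriv (\<lambda>t. W (h - 1) 2 (h - 1) [t, z]) x else 0)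
     + (\<Sum>p\<in>{1..<Suc h}. yf_eval T (t_yf T p) x * terms_eval T (u_terms T (h - p)) x z)
     + (\<Sum>p\<in>{0..<h}. yf_eval T (t_yf T (h - p)) x * terms_eval T (u_terms T p) x z)
     + tquot T (t_yf T h) 2 x z"
proof -
  have diag: "2 \<le> h \<Longrightarrow> W (h - 2) 3 h [x, x, z] = 0"
    by (rule vanish_diag[OF T LF, of 3 x "[z]"]) (use x z xz in \<open>auto simp: excluded_def\<close>)
  have left: "(\<Sum>a\<in>{0..h}. W p 1 a [x] * W (h - p) 2 (h - a) [x, z])
      = yf_eval T (t_yf T p) x * terms_eval T (u_terms T (h - p)) x z" if p: "p \<in> {1..<Suc h}" for p
  proof -
    have "(\<Sum>a\<in>{0..h}. W p 1 a [x] * W (h - p) 2 (h - a) [x, z]) = W p 1 p [x] * W (h - p) 2 (h - p) [x, z]"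
      by (rule convolution_top) (use W1_excluded[OF T LF] W2_excluded x z xz p in auto)
    then show ?thesis using W1_top_eq[OF T LF x, of p] IH[of "h - p" x z] p x z xz by auto
  qed
  have right: "(\<Sum>a\<in>{0..h}. W p 2 a [x, z] * W (h - p) 1 (h - a) [x])
      = yf_eval T (t_yf T (h - p)) x * terms_eval T (u_terms T p) x z" if p: "p \<in> {0..<h}" for p
  proof -
    have "(\<Sum>a\<in>{0..h}. W p 2 a [x, z] * W (h - p) 1 (h - a) [x]) = W p 2 p [x, z] * W (h - p) 1 (h - p) [x]"
      by (rule convolution_top) (use W1_excluded[OF T LF] W2_excluded x z xz p in auto)
    then show ?thesis using W1_top_eq[OF T LF x, of "h - p"] IH[of p x z] p x z xz by auto
  qed
  have residue: "deriv (\<lambda>t. (W h 1 h [x] - W h 1 h [t]) / (x - t)) z = tquot T (t_yf T h) 2 x z"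
    by (rule deriv_diff_quot[OF T x z xz]) (rule W1_top_eq[OF T LF])
  have "ybr T x * W h 2 h [x, z] = loop_rhs T W h 2 h x [z]"
    by (rule loop_eq[OF LF]) (use x z xz in auto)
  also have "\<dots> = (if 1 \<le> h then deriv (\<lambda>t. W (h - 1) 2 (h - 1) [t, z]) x else 0)
     + (\<Sum>p\<in>{1..<Suc h}. yf_eval T (t_yf T p) x * terms_eval T (u_terms T (h - p)) x z)
     + (\<Sum>p\<in>{0..<h}. yf_eval T (t_yf T (h - p)) x * terms_eval T (u_terms T p) x z)
     + tquot T (t_yf T h) 2 x z"
  proof -
    have "(\<Sum>p\<in>{1..<Suc h}. \<Sum>a\<in>{0..h}. W p 1 a [x] * W (h - p) 2 (h - a) [x, z])
        = (\<Sum>p\<in>{1..<Suc h}. yf_eval T (t_yf T p) x * terms_eval T (u_terms T (h - p)) x z)"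
      by (rule sum.cong[OF refl left])
    moreover have "(\<Sum>p\<in>{0..<h}. \<Sum>a\<in>{0..h}. W p 2 a [x, z] * W (h - p) 1 (h - a) [x])
        = (\<Sum>p\<in>{0..<h}. yf_eval T (t_yf T (h - p)) x * terms_eval T (u_terms T p) x z)"
      by (rule sum.cong[OF refl right])
    ultimately show ?thesis unfolding loop_rhs_2 sum_drop_first sum_drop_last residue using diag by simp
  qed
  finally show ?thesis .
qed

lemma W2_top_eq: "x \<in> Ucut T \<Longrightarrow> z \<in> Ucut T \<Longrightarrow> x \<noteq> z \<Longrightarrow> W h 2 h [x, z] = terms_eval T (u_terms T h) x z"
proof (induction h arbitrary: x z rule: less_induct)
  case (less h)
  note x = less.prems(1) and z = less.prems(2) and xz = less.prems(3)
  note loop = W2_top_loop[OF x z xz less.IH]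
  have y0: "ybr T x \<noteq> 0" by (rule ybr_nonzero[OF T x])
  show ?case
  proof (cases h)
    case 0
    then show ?thesis using loop y0 by (simp add: u_terms.simps yf_inv_y_def yf_eval.simps field_simps)
  next
    case (Suc g)
    have "eventually (\<lambda>t. W g 2 g [t, z] = terms_eval T (u_terms T g) t z) (nhds x)"
      unfolding eventually_nhds using x xz z less.IH[of g] Suc open_Ucut
      by (intro exI[of _ "Ucut T - {z}"]) (auto simp: open_Diff)
    then have "deriv (\<lambda>t. W g 2 g [t, z]) x = deriv (\<lambda>t. terms_eval T (u_terms T g) t z) x"
      by (rule deriv_cong_ev) simp
    also have "\<dots> = terms_eval T (terms_deriv T (u_terms T g)) x z"
      by (rule DERIV_imp_deriv[OF terms_eval_deriv[OF T x xz]])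
    finally have "ybr T x * W h 2 h [x, z] = ybr T x * terms_eval T (u_terms T h) x z"
      using loop y0 unfolding Suc u_terms.simps
      by (simp add: terms_eval_divy[OF T x] terms_eval_concat terms_eval_mult[OF T x] sum_set_upt_conv_sum_list_nat[symmetric]
          yf_one_def yf_eval.simps comp_def del: upt_Suc)
    then show ?thesis using y0 by simp
  qed
qed

lemma terms_eval_lim: "x \<in> Ucut T \<Longrightarrow> ((\<lambda>z. terms_eval T L x z) \<longlongrightarrow> terms_diag T L x) (at x)"
proof (induction L)
  case Nil then show ?case by simp
next
  case (Cons tterm L)
  obtain a F k where tterm: "tterm = (a,F,k)" by (cases tterm) auto
  have "((\<lambda>z. yf_eval T a x * tquot T F k x z + terms_eval T L x z) \<longlongrightarrow> yf_eval T a x * (yf_eval T (yf_derivs T k F) x / fact k) + terms_diag T L x) (at x)"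
    by (intro tendsto_add tendsto_mult tendsto_const tquot_lim[OF T Cons.prems] Cons.IH[OF Cons.prems])
  then show ?case by (simp add: tterm)
qed

(* Hence, by regularity on the diagonal, W_2^(h)(x,x)[hbar^h] is the y-fraction diag_yf T h. *)
lemma W2_top_diag_eq: "x \<in> Ucut T \<Longrightarrow> W h 2 h [x, x] = terms_diag T (u_terms T h) x"
proof -
  assume x: "x \<in> Ucut T"
  have l1: "((\<lambda>z. W h 2 h [x, z]) \<longlongrightarrow> W h 2 h [x, x]) (at x)"
    by (rule loop_diag_lim[OF LF, of 2 x "[]"]) (use x in auto)
  have near: "eventually (\<lambda>z. terms_eval T (u_terms T h) x z = W h 2 h [x, z]) (at x)"
    unfolding eventually_at_topological using open_Ucut x W2_top_eq[OF x] by (intro exI[of _ "Ucut T"]) auto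
  have l2: "((\<lambda>z. W h 2 h [x, z]) \<longlongrightarrow> terms_diag T (u_terms T h) x) (at x)"
    by (rule tendsto_cong[THEN iffD1, OF near terms_eval_lim[OF x]])
  show ?thesis by (rule tendsto_unique[OF _ l1 l2]) simp
qed

end

section \<open>The subleading coefficient s_g = [hbar^(g-2)] W_1^(g)\<close>

(* With n = 1 and j = g - 2 the loop equation for G = g + 2 reads
     y s_G = s_(G-1)' + D_g + sum_(p=1..g) t_p s_(G-p) + sum_(p=2..G-1) s_p t_(G-p),
   where D_g = W_2^(g)(x,x)[hbar^g] is the diagonal of u_g and s_1 = 0. *)
fun s_yf :: "real \<Rightarrow> nat \<Rightarrow> yfrac" where
  "s_yf T 0 = (0,0,0)"
| "s_yf T (Suc 0) = (0,0,0)"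
| "s_yf T (Suc (Suc g)) = yf_divy (yf_sum T (3*g+4)
      ((if g = 0 then [] else [yf_deriv T (s_yf T (Suc g))]) @ diag_yf T g
        # map (\<lambda>p. yf_mult T (t_yf T p) (s_yf T (Suc (Suc g) - p))) [1..<Suc g]
        @ map (\<lambda>p. yf_mult T (s_yf T p) (t_yf T (Suc (Suc g) - p))) [2..<Suc (Suc g)]))"

declare s_yf.simps[simp del]

abbreviation s_summands :: "real \<Rightarrow> nat \<Rightarrow> yfrac list" where
  "s_summands T g \<equiv> (if g = 0 then [] else [yf_deriv T (s_yf T (Suc g))]) @ diag_yf T g
        # map (\<lambda>p. yf_mult T (t_yf T p) (s_yf T (Suc (Suc g) - p))) [1..<Suc g]
        @ map (\<lambda>p. yf_mult T (s_yf T p) (t_yf T (Suc (Suc g) - p))) [2..<Suc (Suc g)]"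

lemma s_yf_Suc_Suc: "s_yf T (Suc (Suc g)) = yf_divy (yf_sum T (3*g+4) (s_summands T g))"
  by (simp add: s_yf.simps)


lemma s_summands_props:
  assumes IH: "\<And>p. 2 \<le> p \<Longrightarrow> p \<le> Suc g \<Longrightarrow> yexp (s_yf T p) = 3*p - 1 \<and> tame (2 * int p - 1) (s_yf T p)"
    and X: "X \<in> set (s_summands T g)"
  shows "tame (2 * int g + 2) X \<and> yexp X \<le> 3*g+4"
proof -
  let ?G = "Suc (Suc g)"
  consider "g \<noteq> 0" "X = yf_deriv T (s_yf T (Suc g))" | "X = diag_yf T g"
    | p where "p \<in> {1..<Suc g}" "X = yf_mult T (t_yf T p) (s_yf T (?G - p))"
    | p where "p \<in> {2..<?G}" "X = yf_mult T (s_yf T p) (t_yf T (?G - p))"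
    using X by (auto split: if_splits simp del: upt_Suc)
  then show ?thesis
  proof cases
    case 1
    have "tame (2 * int (Suc g) - 1 + 1) X" unfolding 1 using IH[of "Suc g"] 1 by (intro tame_deriv) auto
    then show ?thesis using IH[of "Suc g"] 1 yexp_deriv_le[of T "s_yf T (Suc g)"] by (simp add: algebra_simps)
  next
    case 2 then show ?thesis using diag_yf_props[of g T] by simp
  next
    case (3 p)
    have w: "2 * int p - 1 + (2 * int (?G - p) - 1) = 2 * int g + 2" using 3 by auto
    have "tame (2 * int g + 2) X"
      unfolding 3 w[symmetric] using IH[of "?G - p"] 3 by (intro tame_mult_right[OF shaped_t_yf]) auto
    then show ?thesis using IH[of "?G - p"] 3 by (auto simp: yexp_t_yf)
  next
    case (4 p)
    have w: "2 * int p - 1 + (2 * int (?G - p) - 1) = 2 * int g + 2" using 4 by auto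
    have "tame (2 * int g + 2) X"
      unfolding 4 w[symmetric] using IH[of p] 4 by (intro tame_mult_left[OF _ shaped_t_yf]) auto
    then show ?thesis using IH[of p] 4 by (auto simp: yexp_t_yf)
  qed
qed

lemma s_yf_props: "2 \<le> G \<Longrightarrow> yexp (s_yf T G) = 3*G - 1 \<and> tame (2 * int G - 1) (s_yf T G)"
proof (induction G rule: less_induct)
  case (less G)
  obtain g where G: "G = Suc (Suc g)" using less.prems by (metis add_2_eq_Suc le_Suc_ex)
  have IH: "\<And>p. 2 \<le> p \<Longrightarrow> p \<le> Suc g \<Longrightarrow> yexp (s_yf T p) = 3*p - 1 \<and> tame (2 * int p - 1) (s_yf T p)"
    using less.IH G by auto
  have "tame (2 * int g + 2) (yf_sum T (3*g+4) (s_summands T g)) \<and> yexp (yf_sum T (3*g+4) (s_summands T g)) = 3*g+4"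
    by (rule tame_sum[OF s_summands_props[OF IH]]) simp_all
  then show ?case using tame_divy[of "2 * int g + 2" "yf_sum T (3*g+4) (s_summands T g)"] G
    by (simp add: s_yf_Suc_Suc algebra_simps)
qed

context fixes T :: real and W assumes T: "0 < T" and LF: "loop_family T W"
begin

lemma W1_sub_products:
  assumes x: "x \<in> Ucut T" and G: "G = Suc (Suc g)"
    and IH: "\<And>p t. 2 \<le> p \<Longrightarrow> p < G \<Longrightarrow> t \<in> Ucut T \<Longrightarrow> W p 1 (p - 2) [t] = yf_eval T (s_yf T p) t"
  shows "(\<Sum>p\<in>{0..G}. if p = 0 \<or> p = G then 0 else (\<Sum>a\<in>{0..g}. W p 1 a [x] * W (G - p) 1 (g - a) [x]))
      = (\<Sum>p\<in>{1..<Suc g}. yf_eval T (t_yf T p) x * yf_eval T (s_yf T (G - p)) x)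
      + (\<Sum>p\<in>{2..<G}. yf_eval T (s_yf T p) x * yf_eval T (t_yf T (G - p)) x)"
proof -
  have inner: "(\<Sum>a\<in>{0..g}. W p 1 a [x] * W (G - p) 1 (g - a) [x])
     = (if p \<le> g then yf_eval T (t_yf T p) x * yf_eval T (s_yf T (G - p)) x else 0)
     + (if 2 \<le> p then yf_eval T (s_yf T p) x * yf_eval T (t_yf T (G - p)) x else 0)"
    if p: "p \<in> {1..<G}" for p
  proof -
    have "(\<Sum>a\<in>{0..g}. W p 1 a [x] * W (G - p) 1 (g - a) [x])
      = (if 2 \<le> G - p then W p 1 p [x] * W (G - p) 1 (G - p - 2) [x] else 0)
      + (if 2 \<le> p then W p 1 (p - 2) [x] * W (G - p) 1 (G - p) [x] else 0)"
      by (rule convolution_sub) (use W1_excluded[OF T LF] x p G in auto)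
    moreover have "2 \<le> G - p \<longleftrightarrow> p \<le> g" using G by auto
    moreover have "p \<le> g \<Longrightarrow> W p 1 p [x] * W (G - p) 1 (G - p - 2) [x] = yf_eval T (t_yf T p) x * yf_eval T (s_yf T (G - p)) x"
      using W1_top_eq[OF T LF x, of p] IH[of "G - p" x] p G x by auto
    moreover have "2 \<le> p \<Longrightarrow> W p 1 (p - 2) [x] * W (G - p) 1 (G - p) [x] = yf_eval T (s_yf T p) x * yf_eval T (t_yf T (G - p)) x"
      using W1_top_eq[OF T LF x, of "G - p"] IH[of p x] p x by auto
    ultimately show ?thesis by simp
  qed
  have "(\<Sum>p\<in>{0..G}. if p = 0 \<or> p = G then 0 else (\<Sum>a\<in>{0..g}. W p 1 a [x] * W (G - p) 1 (g - a) [x]))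
     = (\<Sum>p\<in>{1..<G}. (if p \<le> g then yf_eval T (t_yf T p) x * yf_eval T (s_yf T (G - p)) x else 0)
        + (if 2 \<le> p then yf_eval T (s_yf T p) x * yf_eval T (t_yf T (G - p)) x else 0))"
    unfolding sum_drop_ends by (rule sum.cong[OF refl inner])
  also have "\<dots> = (\<Sum>p\<in>{1..<Suc g}. yf_eval T (t_yf T p) x * yf_eval T (s_yf T (G - p)) x)
      + (\<Sum>p\<in>{2..<G}. yf_eval T (s_yf T p) x * yf_eval T (t_yf T (G - p)) x)"
    unfolding sum.distrib
    by (intro arg_cong2[where f="(+)"] sum.mono_neutral_cong_right) (use G in auto)
  finally show ?thesis .
qed

lemma W1_sub_eq: "2 \<le> G \<Longrightarrow> x \<in> Ucut T \<Longrightarrow> W G 1 (G - 2) [x] = yf_eval T (s_yf T G) x"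
proof (induction G arbitrary: x rule: less_induct)
  case (less G)
  note x = less.prems(2)
  obtain g where G: "G = Suc (Suc g)" using less.prems by (metis add_2_eq_Suc le_Suc_ex)
  have IH: "\<And>p t. 2 \<le> p \<Longrightarrow> p < G \<Longrightarrow> t \<in> Ucut T \<Longrightarrow> W p 1 (p - 2) [t] = yf_eval T (s_yf T p) t"
    using less.IH by blast
  have deriv_term: "(if 1 \<le> G \<and> 1 \<le> g then deriv (\<lambda>t. W (G - 1) 1 (g - 1) [t]) x else 0)
      = (if g = 0 then 0 else yf_eval T (yf_deriv T (s_yf T (Suc g))) x)"
  proof (cases "g = 0")
    case False
    have "deriv (\<lambda>t. W (Suc g) 1 (g - 1) [t]) x = yf_eval T (yf_deriv T (s_yf T (Suc g))) x"
      by (rule deriv_eq_yf_eval[OF T x]) (use IH[of "Suc g"] False G in auto)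
    then show ?thesis using False G by simp
  qed simp
  have diag_term: "(if 2 \<le> G then W (G - 2) 2 g [x, x] else 0) = yf_eval T (diag_yf T g) x"
    using W2_top_diag_eq[OF T LF x, of g] yf_eval_diag_yf[OF T x, of g] G by simp
  have "\<And>p. 2 \<le> p \<Longrightarrow> p \<le> Suc g \<Longrightarrow> yexp (s_yf T p) = 3*p - 1 \<and> tame (2 * int p - 1) (s_yf T p)"
    by (rule s_yf_props)
  then have bound: "\<And>X. X \<in> set (s_summands T g) \<Longrightarrow> yexp X \<le> 3*g+4"
    using s_summands_props by blast
  have "ybr T x * W G 1 g [x] = loop_rhs T W G 1 g x []"
    by (rule loop_eq[OF LF]) (use G x in auto)
  also have "\<dots> = (if g = 0 then 0 else yf_eval T (yf_deriv T (s_yf T (Suc g))) x) + yf_eval T (diag_yf T g) x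
      + ((\<Sum>p\<in>{1..<Suc g}. yf_eval T (t_yf T p) x * yf_eval T (s_yf T (G - p)) x)
      + (\<Sum>p\<in>{2..<G}. yf_eval T (s_yf T p) x * yf_eval T (t_yf T (G - p)) x))"
    using W1_sub_products[OF x G IH] unfolding loop_rhs_1[OF T LF x] deriv_term diag_term by simp
  also have "\<dots> = (\<Sum>X\<leftarrow>s_summands T g. yf_eval T X x)"
    by (simp add: G yf_eval_mult[OF T x] sum_set_upt_conv_sum_list_nat[symmetric] comp_def del: upt_Suc)
  also have "\<dots> = yf_eval T (yf_sum T (3*g+4) (s_summands T g)) x"
    by (rule yf_eval_sum[OF T x bound, symmetric])
  finally show ?case using ybr_nonzero[OF T x] unfolding G s_yf_Suc_Suc yf_eval_divy[OF T x] by (simp add: field_simps)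
qed

end

(* Reading off the components of s_g: with s_yf T g = (A, B, 3g - 1) of weight 2g - 1,
   A has degree <= g and parity g, B has degree <= g - 1 and parity g - 1, and the vanishing
   top coefficient says coeff A g + coeff B (g - 1) = 0. *)
lemma s_yf_components:
  assumes g: "2 \<le> g" and S: "s_yf T g = (A, B, M)"
  shows "M = 3*g - 1" "degree A \<le> g" "degree B \<le> g - 1"
    "\<And>x. poly A (- x) = (-1) ^ g * poly A x" "\<And>x. poly B (- x) = (-1) ^ (g - 1) * poly B x"
    "coeff B (g - 1) = - coeff A g"
proof -
  have P: "yexp (s_yf T g) = 3*g - 1" "tame (2 * int g - 1) (s_yf T g)"
    using s_yf_props[OF g, of T] by auto
  show M: "M = 3*g - 1" using P(1) S by simp
  have sM: "int M - (2 * int g - 1) = int g" using M g by auto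
  have h: "deg_le A (int g)" "deg_le B (int g - 1)" "parity A (int g)" "parity B (int g + 1)"
    and top: "coeff (A + [:0,1:] * B) g = 0"
    using P(2) unfolding S tame_def shaped.simps top_coeff.simps sM by auto
  show "degree A \<le> g" using h(1) by (auto simp: deg_le_def)
  show "degree B \<le> g - 1" using h(2) g by (auto simp: deg_le_def)
  show "poly A (- x) = (-1) ^ g * poly A x" for x using parity_poly_neg[OF h(3)] .
  have "parity B (int (g - 1))" by (rule parity_cong[OF h(4)]) (use g in \<open>simp add: of_nat_diff\<close>)
  then show "poly B (- x) = (-1) ^ (g - 1) * poly B x" for x by (rule parity_poly_neg)
  obtain k where k: "g = Suc k" using g by (cases g) auto
  have "coeff (A + [:0,1:] * B) g = coeff A g + coeff B (g - 1)" unfolding k by simp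
  then show "coeff B (g - 1) = - coeff A g" using top by (simp add: eq_neg_iff_add_eq_0 add.commute)
qed

(* W_1^(g)[hbar^(g-2)] = s_g = B/y^(3g-2) + A/y^(3g-1), so C = B and D = A. *)
theorem theorem1:
  fixes T :: real and g :: nat
    and W :: "nat \<Rightarrow> nat \<Rightarrow> nat \<Rightarrow> complex list \<Rightarrow> complex"
  assumes "0 < T" and "loop_family T W" and "3 \<le> g"
  shows "\<exists>C D :: complex poly.
           (\<forall>x \<in> Ucut T. W g 1 (g - 2) [x]
              = poly C x / ybr T x ^ (3 * g - 2) + poly D x / ybr T x ^ (3 * g - 1))
         \<and> degree C \<le> g - 1 \<and> degree D \<le> g
         \<and> (\<forall>x. poly C (- x) = (-1) ^ (g - 1) * poly C x)
         \<and> (\<forall>x. poly D (- x) = (-1) ^ g * poly D x)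
         \<and> coeff C (g - 1) = - coeff D g"
proof -
  note T = assms(1) and LF = assms(2)
  have g: "2 \<le> g" using assms(3) by simp
  obtain A B M where S: "s_yf T g = (A, B, M)" by (cases "s_yf T g") auto
  note comps = s_yf_components[OF g S]
  have "W g 1 (g - 2) [x] = poly B x / ybr T x ^ (3 * g - 2) + poly A x / ybr T x ^ (3 * g - 1)"
    if x: "x \<in> Ucut T" for x
  proof -
    have e: "3 * g - 1 = Suc (3 * g - 2)" using g by auto
    have "W g 1 (g - 2) [x] = (poly A x + poly B x * ybr T x) / ybr T x ^ (3 * g - 1)"
      using W1_sub_eq[OF T LF g x] by (simp add: S comps(1) yf_eval.simps)
    then show ?thesis unfolding e using ybr_nonzero[OF T x] by (simp add: field_simps)
  qed
  then show ?thesis using comps(2-6) by blast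
qed

end
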